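(* Let $(X,d,\mu)$ be a complete metric measure space with $\mu$ a doubling measure supporting a $p$-Poincaré inequality for some $1\le p<\infty$, and let $\xi$ be a doubling gauge function which has codimension strictly greater than $p$. For every $\widehat{C}\ge1$ there exist constants $C_2\ge1$ and $\Delta>0$ such that any domain $\Omega\subsetneq X$ and any $\delta\in(0,1)$ satisfy the following property. If for all $x_0\in\Omega$ we have $$\mathcal{H}^\xi_{d(x_0,\partial\Omega)}\big(B(x_0,\widehat{C}\,d(x_0,\partial\Omega))\setminus\Omega\big)\ \ge\ \delta\,\xi\big(B(x_0,d(x_0,\partial\Omega))\big),$$ then for all $x_0\in\Omega$ we have $$\mathcal{H}^\xi_{d(x_0,\partial\Omega)}\big(\partial\Omega\cap B(x_0,C_2\,d(x_0,\partial\Omega))\big)\ \ge\ \Delta\,\delta\,\xi\big(B(x_0,d(x_0,\partial\Omega))\big).$$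
   Context: A metric measure space $(X,d,\mu)$ is a separable metric space with a Radon measure $\mu$. Open balls are $B(x,r)=\{y: d(x,y)<r\}$, $r>0$; each ball carries a specified center and radius, and $\mathrm{rad}(B(x,r))=r$. A domain is a nonempty open connected set, and $d(z,\partial\Omega)=\inf\{d(z,y):y\in\partial\Omega\}$. Doubling measure: there is $D_\mu\ge1$ with $0<\mu(B(x,2r))\le D_\mu\,\mu(B(x,r))<\infty$ for all balls. Curves are continuous maps from compact intervals. A Borel function $g:X\to[0,\infty]$ is an upper gradient of $f$ if $|f(\gamma(0))-f(\gamma(1))|\le\int_\gamma g\,ds$ for all rectifiable curves $\gamma:[0,1]\to X$. The $p$-Poincaré inequality: there are constants $C_P,\lambda\ge 1$ such that for all $f\in L^1_{\rm loc}(X)$, all upper gradients $g$ of $f$ and all balls $B(x,r)$, $\frac1{\mu(B(x,r))}\int_{B(x,r)}|f-f_{B(x,r)}|\,d\mu\le C_P\,r\left(\frac1{\mu(B(x,\lambda r))}\int_{B(x,\lambda r)}g^p\,d\mu\right)^{1/p}$, where $f_A=\frac1{\mu(A)}\int_A f\,d\mu$. A gauge function $\xi$ assigns to each open ball $B$ a number $\xi(B)\in(0,\infty)$. It is doubling if there is a constant $D_\xi$ such that for all balls $B,B'$ with $B\cap B'\ne\emptyset$ and $\mathrm{rad}(B')\le\mathrm{rad}(B)\le2\,\mathrm{rad}(B')$ one has $D_\xi^{-1}\xi(B')\le\xi(B)\le D_\xi\,\xi(B')$. Put $h_Q(B)=\mu(B)/\mathrm{rad}(B)^Q$. $\xi$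 has codimension at least $Q$ if there is $K\ge1$ such that for all $x\in X$ and $0<r\le R$, $\frac{\xi(B(x,R))}{\xi(B(x,r))}\le K\frac{h_Q(B(x,R))}{h_Q(B(x,r))}$. $\xi$ has codimension strictly greater than $p$ if it has codimension at least $Q$ for some $Q>p$. For $A\subset X$ and $r\in(0,\infty]$, $\mathcal{H}^\xi_r(A)=\inf\{\sum_{B\in\mathcal C}\xi(B)\}$, the infimum over countable collections $\mathcal C$ of open balls with $A\subset\bigcup_{B\in\mathcal C}B$ and $\sup_{B\in\mathcal C}\mathrm{rad}(B)\le r$. *)

theory Defs
  imports "HOL-Analysis.Analysis"
begin

definition radon_measure :: "'a::metric_space measure \<Rightarrow> bool" where
  "radon_measure M \<longleftrightarrow>
     sets M = sets borel \<and>
     (\<forall>K. compact K \<longrightarrow> emeasure M K < \<infinity>) \<and>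
     (\<forall>A\<in>sets borel. emeasure M A = (INF U\<in>{U. open U \<and> A \<subseteq> U}. emeasure M U)) \<and>
     (\<forall>U. open U \<longrightarrow> emeasure M U = (SUP K\<in>{K. compact K \<and> K \<subseteq> U}. emeasure M K))"

definition doubling_measure :: "'a::metric_space measure \<Rightarrow> bool" where
  "doubling_measure M \<longleftrightarrow>
     (\<exists>D::real. D \<ge> 1 \<and>
       (\<forall>x r. r > 0 \<longrightarrow>
          0 < emeasure M (ball x (2 * r)) \<and>
          emeasure M (ball x (2 * r)) \<le> ennreal D * emeasure M (ball x r) \<and>
          ennreal D * emeasure M (ball x r) < \<infinity>))"

definition curve_length :: "(real \<Rightarrow> 'a::metric_space) \<Rightarrow> real \<Rightarrow> real \<Rightarrow> ennreal" where
  "curve_length \<gamma> a b =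
     (SUP ts\<in>{ts. sorted ts \<and> set ts \<subseteq> {a..b}}.
        \<Sum>i<length ts - 1. ennreal (dist (\<gamma> (ts ! i)) (\<gamma> (ts ! Suc i))))"

definition rectifiable_curve :: "(real \<Rightarrow> 'a::metric_space) \<Rightarrow> bool" where
  "rectifiable_curve \<gamma> \<longleftrightarrow> path \<gamma> \<and> curve_length \<gamma> 0 1 < \<infinity>"

text \<open>The choice of \<open>t\<close> is immaterial: a rectifiable curve is constant between
  two parameters at which its length function agrees.\<close>

definition arc_length_param :: "(real \<Rightarrow> 'a::metric_space) \<Rightarrow> real \<Rightarrow> 'a" where
  "arc_length_param \<gamma> s = \<gamma> (SOME t. t \<in> {0..1} \<and> curve_length \<gamma> 0 t = ennreal s)"

definition curve_integral :: "(real \<Rightarrow> 'a::metric_space) \<Rightarrow> ('a \<Rightarrow> ennreal) \<Rightarrow> ennreal" where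
  "curve_integral \<gamma> g =
     (\<integral>\<^sup>+s\<in>{0..enn2real (curve_length \<gamma> 0 1)}. g (arc_length_param \<gamma> s) \<partial>lborel)"

definition upper_gradient :: "('a::metric_space \<Rightarrow> real) \<Rightarrow> ('a \<Rightarrow> ennreal) \<Rightarrow> bool" where
  "upper_gradient f g \<longleftrightarrow>
     g \<in> borel_measurable borel \<and>
     (\<forall>\<gamma>. rectifiable_curve \<gamma> \<longrightarrow> ennreal \<bar>f (\<gamma> 0) - f (\<gamma> 1)\<bar> \<le> curve_integral \<gamma> g)"

text \<open>Functions in \<open>L\<^sup>1\<^sub>l\<^sub>o\<^sub>c\<close> are only required to be measurable with respect to the
  completion of the Borel measure \<open>M\<close>. They are genuine functions rather than
  almost-everywhere classes, because upper gradients depend on pointwise values.\<close>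

definition locally_integrable :: "'a::metric_space measure \<Rightarrow> ('a \<Rightarrow> real) \<Rightarrow> bool" where
  "locally_integrable M f \<longleftrightarrow>
     (\<forall>x. \<exists>r>0. set_integrable (completion M) (ball x r) f)"

definition average :: "'a measure \<Rightarrow> 'a set \<Rightarrow> ('a \<Rightarrow> real) \<Rightarrow> real" where
  "average M A f = (LINT y:A|completion M. f y) / measure M A"

definition nn_average :: "'a measure \<Rightarrow> 'a set \<Rightarrow> ('a \<Rightarrow> ennreal) \<Rightarrow> ennreal" where
  "nn_average M A g = (\<integral>\<^sup>+y\<in>A. g y \<partial>completion M) / emeasure M A"

text \<open>Powers on \<open>[0,\<infinity>]\<close>, meant for exponents \<open>s > 0\<close>.\<close>

definition ennpowr :: "ennreal \<Rightarrow> real \<Rightarrow> ennreal" where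
  "ennpowr t s = (if t = \<infinity> then \<infinity> else ennreal (enn2real t powr s))"

definition poincare_inequality :: "'a::metric_space measure \<Rightarrow> real \<Rightarrow> bool" where
  "poincare_inequality M p \<longleftrightarrow>
     (\<exists>C L::real. C \<ge> 1 \<and> L \<ge> 1 \<and>
       (\<forall>f g x r. locally_integrable M f \<longrightarrow> upper_gradient f g \<longrightarrow> r > 0 \<longrightarrow>
          nn_average M (ball x r) (\<lambda>y. ennreal \<bar>f y - average M (ball x r) f\<bar>)
            \<le> ennreal (C * r) *
               ennpowr (nn_average M (ball x (L * r)) (\<lambda>y. ennpowr (g y) p)) (1 / p)))"

text \<open>Balls carry their centre and radius, so a gauge function is a function of the pair
  \<open>(x, r)\<close>; distinct pairs may describe the same set but have different gauges. Only the
  values for \<open>r > 0\<close> are relevant.\<close>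

definition gauge_function :: "('a \<Rightarrow> real \<Rightarrow> real) \<Rightarrow> bool" where
  "gauge_function \<xi> \<longleftrightarrow> (\<forall>x r. r > 0 \<longrightarrow> \<xi> x r > 0)"

definition doubling_gauge :: "('a::metric_space \<Rightarrow> real \<Rightarrow> real) \<Rightarrow> bool" where
  "doubling_gauge \<xi> \<longleftrightarrow>
     (\<exists>D::real. \<forall>x r x' r'.
        0 < r \<longrightarrow> 0 < r' \<longrightarrow> ball x r \<inter> ball x' r' \<noteq> {} \<longrightarrow> r' \<le> r \<longrightarrow> r \<le> 2 * r' \<longrightarrow>
        inverse D * \<xi> x' r' \<le> \<xi> x r \<and> \<xi> x r \<le> D * \<xi> x' r')"

definition codim_gauge :: "'a::metric_space measure \<Rightarrow> real \<Rightarrow> 'a \<Rightarrow> real \<Rightarrow> real" where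
  "codim_gauge M Q x r = measure M (ball x r) / r powr Q"

definition codim_at_least ::
  "'a::metric_space measure \<Rightarrow> ('a \<Rightarrow> real \<Rightarrow> real) \<Rightarrow> real \<Rightarrow> bool" where
  "codim_at_least M \<xi> Q \<longleftrightarrow>
     (\<exists>K::real. K \<ge> 1 \<and>
       (\<forall>x r R. 0 < r \<longrightarrow> r \<le> R \<longrightarrow>
          \<xi> x R / \<xi> x r \<le> K * (codim_gauge M Q x R / codim_gauge M Q x r)))"

definition codim_greater ::
  "'a::metric_space measure \<Rightarrow> ('a \<Rightarrow> real \<Rightarrow> real) \<Rightarrow> real \<Rightarrow> bool" where
  "codim_greater M \<xi> p \<longleftrightarrow> (\<exists>Q>p. codim_at_least M \<xi> Q)"

definition hausdorff_content ::
  "('a::metric_space \<Rightarrow> real \<Rightarrow> real) \<Rightarrow> ennreal \<Rightarrow> 'a set \<Rightarrow> ennreal" where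
  "hausdorff_content \<xi> r A =
     (INF \<C>\<in>{\<C> :: ('a \<times> real) set. countable \<C> \<and>
                (\<forall>(x, s)\<in>\<C>. 0 < s \<and> ennreal s \<le> r) \<and>
                A \<subseteq> (\<Union>(x, s)\<in>\<C>. ball x s)}.
        \<Sum>\<^sub>\<infinity>(x, s)\<in>\<C>. ennreal (\<xi> x s))"

definition domain :: "'a::metric_space set \<Rightarrow> bool" where
  "domain \<Omega> \<longleftrightarrow> \<Omega> \<noteq> {} \<and> open \<Omega> \<and> connected \<Omega>"

end

theory Submission
  imports Defs
begin

text \<open>
  Write \<open>r\<close> for the distance from \<open>x0\<close> to the boundary and let countably many balls
  \<open>B\<^sub>i\<close> of radii \<open>r\<^sub>i \<le> r\<close> cover the boundary near \<open>x0\<close>. It suffices to cover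
  \<open>B(x0, C_hat r) - \<Omega>\<close> by balls of radii at most \<open>r\<close> whose total gauge is at most a constant times
  \<open>\<Sum>\<^sub>i \<xi>(B\<^sub>i)\<close>; this is a boxing inequality. A point \<open>z\<close> outside the closure of \<open>\<Omega>\<close> sees only the
  complement at small scales and, as \<open>\<Omega>\<close> contains a ball around \<open>x0\<close> of radius comparable to \<open>r\<close>,
  a fixed proportion of \<open>\<Omega>\<close> at scale \<open>r\<close>. Hence at some scale \<open>s\<close> both sets have measure
  comparable to that of \<open>B(z, s)\<close>. The function that is \<open>1\<close> on \<open>\<Omega>\<close> and on all \<open>B\<^sub>i\<close>, and decays
  linearly to \<open>0\<close> across \<open>2B\<^sub>i - B\<^sub>i\<close> outside \<open>\<Omega>\<close>, has an upper gradient \<open>g\<close> with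
  \<open>g\<^sup>p = \<Sum>\<^sub>i r\<^sub>i\<^bsup>-p\<^esup> 1\<^bsub>2B\<^sub>i\<^esub>\<close>, since a curve can only leave \<open>\<Omega>\<close> through some \<open>B\<^sub>i\<close>. The Poincare inequality
  then bounds \<open>s\<^bsup>-p\<^esup> \<mu>(B(z, s))\<close> by \<open>\<Sum>\<^sub>i r\<^sub>i\<^bsup>-p\<^esup> \<mu>(2B\<^sub>i)\<close>, and the codimension condition turns this
  into \<open>\<xi>(B(z, s)) \<le> C \<Sum>\<^sub>i \<xi>(B\<^sub>i)\<close>, the sum being over the \<open>B\<^sub>i\<close> near \<open>B(z, s)\<close>. A Vitali covering
  argument sums this over \<open>z\<close>; points close to some \<open>B\<^sub>i\<close> with \<open>r\<^sub>i \<ge> s\<close> lie in a fixed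
  enlargement of that \<open>B\<^sub>i\<close>.
\<close>

section \<open>Sums in the extended nonnegative reals\<close>

text \<open>The library's \<open>summable_on_ennreal\<close> only applies to functions of the form \<open>ennreal_of_enat \<circ> f\<close>.\<close>

lemma ennreal_summable_on [simp]:
  fixes f :: "'i \<Rightarrow> ennreal"
  shows "f summable_on A"
  by (rule nonneg_summable_on_complete) simp

lemma infsum_ennreal_mono_set:
  fixes f :: "'i \<Rightarrow> ennreal"
  assumes "A \<subseteq> B"
  shows "infsum f A \<le> infsum f B"
  using assms by (intro infsum_mono_neutral) auto

lemma finite_sum_le_infsum_ennreal:
  fixes f :: "'i \<Rightarrow> ennreal"
  assumes "finite F" "F \<subseteq> A"
  shows "sum f F \<le> infsum f A"
  using infsum_ennreal_mono_set[OF assms(2), of f] assms(1) by simp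

text \<open>Every element of a finite part of the union is charged to one chosen index
  \<open>h i\<close>, so overlaps between the sets are harmless.\<close>

lemma infsum_UN_le_ennreal:
  fixes f :: "'i \<Rightarrow> ennreal"
  shows "infsum f (\<Union>j\<in>J. A j) \<le> (\<Sum>\<^sub>\<infinity>j\<in>J. infsum f (A j))"
proof (rule infsum_le_finite_sums)
  fix F assume F: "finite F" "F \<subseteq> (\<Union>j\<in>J. A j)"
  then obtain h where h: "\<And>i. i \<in> F \<Longrightarrow> h i \<in> J \<and> i \<in> A (h i)"
    by (metis UN_E subsetD)
  have "sum f F = (\<Sum>j\<in>h ` F. \<Sum>i\<in>{i\<in>F. h i = j}. f i)"
    by (rule sum.image_gen[OF F(1)])
  also have "\<dots> \<le> (\<Sum>j\<in>h ` F. infsum f (A j))"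
    using h F(1) by (intro sum_mono finite_sum_le_infsum_ennreal) fastforce+
  also have "\<dots> \<le> (\<Sum>\<^sub>\<infinity>j\<in>J. infsum f (A j))"
    using h F(1) by (intro finite_sum_le_infsum_ennreal) auto
  finally show "sum f F \<le> (\<Sum>\<^sub>\<infinity>j\<in>J. infsum f (A j))" .
qed simp

lemma infsum_Un_le_ennreal:
  fixes f :: "'i \<Rightarrow> ennreal"
  shows "infsum f (A \<union> B) \<le> infsum f A + infsum f B"
proof -
  have "infsum f (A \<union> (B - A)) = infsum f A + infsum f (B - A)"
    by (rule infsum_Un_disjoint) auto
  also have "\<dots> \<le> infsum f A + infsum f B"
    by (intro add_left_mono infsum_ennreal_mono_set) auto
  finally show ?thesis by simp
qed

text \<open>Disjointness prevents double counting. It serves to add up boxing estimates whose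
  right-hand sides use disjoint parts of one cover.\<close>

lemma infsum_disjoint_family_le_ennreal:
  fixes f :: "'i \<Rightarrow> ennreal"
  assumes "disjoint_family_on A J" "\<And>j. j \<in> J \<Longrightarrow> A j \<subseteq> B"
  shows "(\<Sum>\<^sub>\<infinity>j\<in>J. infsum f (A j)) \<le> infsum f B"
proof (rule infsum_le_finite_sums)
  fix F assume F: "finite F" "F \<subseteq> J"
  have "(\<Sum>j\<in>F. infsum f (A j)) = infsum f (\<Union>j\<in>F. A j)"
    using F
  proof (induction F)
    case (insert j F)
    have "A j \<inter> (\<Union>j\<in>F. A j) = {}"
      using assms(1) insert.hyps insert.prems unfolding disjoint_family_on_def by fastforce
    then show ?case
      using insert by (simp add: infsum_Un_disjoint[symmetric])
  qed simp
  also have "\<dots> \<le> infsum f B"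
    using F assms(2) by (intro infsum_ennreal_mono_set) auto
  finally show "(\<Sum>j\<in>F. infsum f (A j)) \<le> infsum f B" .
qed simp

text \<open>Bridge from unordered sums to series: together with an enumeration of the index set it
  gives access to measurability and monotone convergence for \<open>suminf\<close>.\<close>

lemma infsum_nat_ennreal:
  fixes f :: "nat \<Rightarrow> ennreal"
  shows "infsum f UNIV = suminf f"
  by (rule sums_unique[OF has_sum_imp_sums[OF has_sum_infsum[OF ennreal_summable_on]]])

lemma borel_measurable_infsum_ennreal:
  fixes f :: "'i \<Rightarrow> 'b \<Rightarrow> ennreal"
  assumes "countable C" "\<And>i. i \<in> C \<Longrightarrow> f i \<in> borel_measurable M"
  shows "(\<lambda>x. \<Sum>\<^sub>\<infinity>i\<in>C. f i x) \<in> borel_measurable M"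
proof (cases "finite C")
  case True
  then show ?thesis using assms(2) by simp
next
  case False
  then have bij: "bij_betw (from_nat_into C) UNIV C"
    using assms(1) bij_betw_from_nat_into by blast
  have "(\<lambda>x. \<Sum>\<^sub>\<infinity>i\<in>C. f i x) = (\<lambda>x. \<Sum>n. f (from_nat_into C n) x)"
    by (simp add: infsum_nat_ennreal[symmetric] infsum_reindex_bij_betw[OF bij, symmetric])
  moreover have "f (from_nat_into C n) \<in> borel_measurable M" for n
    using bij assms(2) by (metis UNIV_I bij_betwE)
  ultimately show ?thesis by simp
qed

lemma nn_integral_infsum_ennreal:
  fixes f :: "'i \<Rightarrow> 'b \<Rightarrow> ennreal"
  assumes "countable C" "\<And>i. i \<in> C \<Longrightarrow> f i \<in> borel_measurable M"
  shows "(\<integral>\<^sup>+x. (\<Sum>\<^sub>\<infinity>i\<in>C. f i x) \<partial>M) = (\<Sum>\<^sub>\<infinity>i\<in>C. \<integral>\<^sup>+x. f i x \<partial>M)"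
proof (cases "finite C")
  case True
  then show ?thesis using assms(2) by (simp add: nn_integral_sum)
next
  case False
  then have bij: "bij_betw (from_nat_into C) UNIV C"
    using assms(1) bij_betw_from_nat_into by blast
  have m: "f (from_nat_into C n) \<in> borel_measurable M" for n
    using bij assms(2) by (metis UNIV_I bij_betwE)
  have "(\<integral>\<^sup>+x. (\<Sum>\<^sub>\<infinity>i\<in>C. f i x) \<partial>M) = (\<integral>\<^sup>+x. (\<Sum>n. f (from_nat_into C n) x) \<partial>M)"
    by (simp add: infsum_nat_ennreal[symmetric] infsum_reindex_bij_betw[OF bij, symmetric])
  also have "\<dots> = (\<Sum>n. \<integral>\<^sup>+x. f (from_nat_into C n) x \<partial>M)"
    using m by (rule nn_integral_suminf)
  also have "\<dots> = (\<Sum>\<^sub>\<infinity>i\<in>C. \<integral>\<^sup>+x. f i x \<partial>M)"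
    by (simp add: infsum_nat_ennreal[symmetric] infsum_reindex_bij_betw[OF bij, symmetric])
  finally show ?thesis .
qed

lemma infsum_cmult_ennreal:
  fixes f :: "'i \<Rightarrow> ennreal"
  shows "(\<Sum>\<^sub>\<infinity>i\<in>A. c * f i) = c * infsum f A"
proof -
  have "(\<Sum>\<^sub>\<infinity>i\<in>A. c * f i) = (SUP F\<in>{F. finite F \<and> F \<subseteq> A}. \<Sum>i\<in>F. c * f i)"
    by (rule nonneg_infsum_complete) simp
  also have "\<dots> = (SUP F\<in>{F. finite F \<and> F \<subseteq> A}. c * sum f F)"
    by (simp add: sum_distrib_left)
  also have "\<dots> = c * (SUP F\<in>{F. finite F \<and> F \<subseteq> A}. sum f F)"
    by (rule SUP_mult_left_ennreal[symmetric])
  also have "(SUP F\<in>{F. finite F \<and> F \<subseteq> A}. sum f F) = infsum f A"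
    by (rule nonneg_infsum_complete[symmetric]) simp
  finally show ?thesis .
qed

text \<open>Countable subadditivity for unordered sums: the indicator of the union is at most the
  sum of the indicators, and this is integrated termwise.\<close>

lemma emeasure_UN_le_infsum:
  assumes "countable \<C>" "\<And>i. i \<in> \<C> \<Longrightarrow> A i \<in> sets N"
  shows "emeasure N (\<Union>i\<in>\<C>. A i) \<le> (\<Sum>\<^sub>\<infinity>i\<in>\<C>. emeasure N (A i))"
proof -
  have "emeasure N (\<Union>i\<in>\<C>. A i) = (\<integral>\<^sup>+x. indicator (\<Union>i\<in>\<C>. A i) x \<partial>N)"
    using assms by (subst nn_integral_indicator) (auto intro: sets.countable_UN')
  also have "\<dots> \<le> (\<integral>\<^sup>+x. (\<Sum>\<^sub>\<infinity>i\<in>\<C>. indicator (A i) x) \<partial>N)"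
  proof (intro nn_integral_mono)
    fix x
    show "indicator (\<Union>i\<in>\<C>. A i) x \<le> (\<Sum>\<^sub>\<infinity>i\<in>\<C>. indicator (A i) x :: ennreal)"
    proof (cases "x \<in> (\<Union>i\<in>\<C>. A i)")
      case True
      then obtain i where "i \<in> \<C>" "x \<in> A i" by blast
      then show ?thesis
        using True finite_sum_le_infsum_ennreal[of "{i}" \<C> "\<lambda>i. indicator (A i) x"] by simp
    qed simp
  qed
  also have "\<dots> = (\<Sum>\<^sub>\<infinity>i\<in>\<C>. \<integral>\<^sup>+x. indicator (A i) x \<partial>N)"
    using assms by (intro nn_integral_infsum_ennreal) auto
  also have "\<dots> = (\<Sum>\<^sub>\<infinity>i\<in>\<C>. emeasure N (A i))"
    using assms(2) by (intro infsum_cong) simp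
  finally show ?thesis .
qed

section \<open>Powers on the extended half-line and the bound of a content by an explicit
  cover\<close>

lemma ennpowr_ennpowr_inverse:
  assumes "0 < p"
  shows "ennpowr (ennpowr t (1 / p)) p = t"
  using assms by (cases t) (auto simp: ennpowr_def powr_powr)

lemma ennpowr_mono:
  assumes "0 < p" "s \<le> t"
  shows "ennpowr s p \<le> ennpowr t p"
proof (cases "t = \<infinity>")
  case False
  then have "s \<noteq> \<infinity>" using assms by (auto simp: top_unique)
  with False assms show ?thesis
    by (auto simp: ennpowr_def enn2real_mono less_top intro!: ennreal_leI powr_mono2)
qed (simp add: ennpowr_def)

lemma borel_measurable_ennpowr [measurable (raw)]:
  assumes [measurable]: "f \<in> borel_measurable M"
  shows "(\<lambda>x. ennpowr (f x) p) \<in> borel_measurable M"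
  unfolding ennpowr_def by measurable

lemma hausdorff_content_le:
  assumes "countable \<C>" "\<And>x s. (x, s) \<in> \<C> \<Longrightarrow> 0 < s \<and> ennreal s \<le> r"
    and "A \<subseteq> (\<Union>(x, s)\<in>\<C>. ball x s)"
  shows "hausdorff_content \<xi> r A \<le> (\<Sum>\<^sub>\<infinity>(x, s)\<in>\<C>. ennreal (\<xi> x s))"
  unfolding hausdorff_content_def using assms by (intro INF_lower) auto

section \<open>Arc length\<close>

text \<open>Recursive form of the sum in \<open>curve_length\<close>, suited to induction over the
  list of parameters.\<close>

fun polygon_length :: "(real \<Rightarrow> 'a::metric_space) \<Rightarrow> real list \<Rightarrow> real" where
  "polygon_length \<gamma> (s # t # ts) = dist (\<gamma> s) (\<gamma> t) + polygon_length \<gamma> (t # ts)"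
| "polygon_length \<gamma> ts = 0"

lemma polygon_length_nonneg: "0 \<le> polygon_length \<gamma> ts"
  by (induction \<gamma> ts rule: polygon_length.induct) auto

lemma sum_dist_eq_polygon_length:
  "(\<Sum>i<length ts - 1. ennreal (dist (\<gamma> (ts ! i)) (\<gamma> (ts ! Suc i)))) = ennreal (polygon_length \<gamma> ts)"
proof (induction \<gamma> ts rule: polygon_length.induct)
  case (1 \<gamma> s t ts)
  then show ?case
    using polygon_length_nonneg[of \<gamma> "t # ts"]
    by (simp add: sum.lessThan_Suc_shift del: sum.lessThan_Suc)
qed auto

lemma curve_length_eq_SUP:
  "curve_length \<gamma> a b = (SUP ts\<in>{ts. sorted ts \<and> set ts \<subseteq> {a..b}}. ennreal (polygon_length \<gamma> ts))"
  unfolding curve_length_def sum_dist_eq_polygon_length ..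

lemma polygon_length_le_curve_length:
  "sorted ts \<Longrightarrow> set ts \<subseteq> {a..b} \<Longrightarrow> ennreal (polygon_length \<gamma> ts) \<le> curve_length \<gamma> a b"
  unfolding curve_length_eq_SUP by (intro SUP_upper) auto

lemma curve_length_leI:
  assumes "\<And>ts. sorted ts \<Longrightarrow> set ts \<subseteq> {a..b} \<Longrightarrow> ennreal (polygon_length \<gamma> ts) \<le> M"
  shows "curve_length \<gamma> a b \<le> M"
  unfolding curve_length_eq_SUP using assms by (intro SUP_least) auto

lemma polygon_length_append_ge:
  "polygon_length \<gamma> ts + polygon_length \<gamma> us \<le> polygon_length \<gamma> (ts @ us)"
proof (induction \<gamma> ts rule: polygon_length.induct)
  case ("2_2" \<gamma> t)
  then show ?case by (cases us) auto
qed auto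

text \<open>Inserting the vertex \<open>b\<close> between the two lists cannot shorten the polygon,
  by the triangle inequality.\<close>

lemma polygon_length_append_le:
  "polygon_length \<gamma> (ts @ us) \<le> polygon_length \<gamma> (ts @ [b]) + polygon_length \<gamma> (b # us)"
proof (induction \<gamma> ts rule: polygon_length.induct)
  case ("2_1" \<gamma>)
  then show ?case by (cases us) auto
next
  case ("2_2" \<gamma> t)
  then show ?case by (cases us) (auto simp: dist_triangle)
qed auto

text \<open>One inequality splits a partition of \<open>[a, c]\<close> at \<open>b\<close> and
  inserts \<open>b\<close> as a vertex; the other concatenates partitions of the two
  subintervals.\<close>

lemma curve_length_add:
  assumes "a \<le> b" "b \<le> c"
  shows "curve_length \<gamma> a c = curve_length \<gamma> a b + curve_length \<gamma> b c"
proof (rule antisym)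
  show "curve_length \<gamma> a c \<le> curve_length \<gamma> a b + curve_length \<gamma> b c"
  proof (rule curve_length_leI)
    fix ts assume ts: "sorted ts" "set ts \<subseteq> {a..c}"
    define us vs where "us = filter (\<lambda>t. t \<le> b) ts" and "vs = filter (\<lambda>t. \<not> t \<le> b) ts"
    have "ts = us @ vs"
      using ts(1) unfolding us_def vs_def
    proof (induction ts)
      case (Cons t ts)
      moreover have "filter (\<lambda>t. t \<le> b) ts = []" if "\<not> t \<le> b"
        using Cons.prems that by (auto simp: filter_empty_conv)
      ultimately show ?case
        by (cases "t \<le> b") auto
    qed simp
    then have "ennreal (polygon_length \<gamma> ts)
      \<le> ennreal (polygon_length \<gamma> (us @ [b])) + ennreal (polygon_length \<gamma> (b # vs))"
      using polygon_length_append_le[of \<gamma> us vs b]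
      by (simp add: polygon_length_nonneg flip: ennreal_plus)
    also have "\<dots> \<le> curve_length \<gamma> a b + curve_length \<gamma> b c"
      using ts assms unfolding us_def vs_def
      by (intro add_mono polygon_length_le_curve_length)
         (auto simp: sorted_append intro!: sorted_filter[where f = id, simplified])
    finally show "ennreal (polygon_length \<gamma> ts) \<le> curve_length \<gamma> a b + curve_length \<gamma> b c" .
  qed
next
  have ne: "{ts. sorted ts \<and> set ts \<subseteq> {x..y}} \<noteq> {}" for x y :: real
    by (auto intro: exI[of _ "[]"])
  have "ennreal (polygon_length \<gamma> ts) + ennreal (polygon_length \<gamma> us) \<le> curve_length \<gamma> a c"
    if "sorted ts" "set ts \<subseteq> {a..b}" "sorted us" "set us \<subseteq> {b..c}" for ts us
  proof -
    have "ennreal (polygon_length \<gamma> ts) + ennreal (polygon_length \<gamma> us)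
      \<le> ennreal (polygon_length \<gamma> (ts @ us))"
      using polygon_length_append_ge[of \<gamma> ts us]
      by (simp add: polygon_length_nonneg flip: ennreal_plus)
    also have "\<dots> \<le> curve_length \<gamma> a c"
      using that assms by (intro polygon_length_le_curve_length) (fastforce simp: sorted_append)+
    finally show ?thesis .
  qed
  then show "curve_length \<gamma> a b + curve_length \<gamma> b c \<le> curve_length \<gamma> a c"
    unfolding curve_length_eq_SUP[of \<gamma> a b] curve_length_eq_SUP[of \<gamma> b c]
    by (subst ennreal_SUP_add_left[OF ne, symmetric], intro SUP_least)
       (subst ennreal_SUP_add_right[OF ne], auto intro!: SUP_least)
qed

lemma dist_le_curve_length:
  "a \<le> b \<Longrightarrow> ennreal (dist (\<gamma> a) (\<gamma> b)) \<le> curve_length \<gamma> a b"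
  using polygon_length_le_curve_length[of "[a, b]" a b \<gamma>] by simp

lemma curve_length_trivial: "curve_length \<gamma> a a = 0"
proof -
  have "polygon_length \<gamma> ts = 0" if "set ts \<subseteq> {a..a}" for ts
    using that by (induction \<gamma> ts rule: polygon_length.induct) auto
  then show ?thesis
    by (intro antisym curve_length_leI) auto
qed

lemma continuous_on_polygon_length:
  assumes "continuous_on S \<gamma>" "\<And>t. t \<in> set ts \<Longrightarrow> continuous_on T (\<lambda>x. h x t)"
    "\<And>t x. t \<in> set ts \<Longrightarrow> x \<in> T \<Longrightarrow> h x t \<in> S"
  shows "continuous_on T (\<lambda>x. polygon_length \<gamma> (map (h x) ts))"
  using assms
proof (induction ts rule: induct_list012)
  case (3 s t ts)
  then show ?case
    by (auto intro!: continuous_intros continuous_on_compose2[OF assms(1)])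
qed auto

text \<open>Clamping the vertices of a polygon to \<open>[0, t]\<close> makes its length continuous in \<open>t\<close>. Since the
  lengths over \<open>[0, t]\<close> and \<open>[t, 1]\<close> have constant sum, the two lower bounds together give continuity.\<close>

lemma curve_length_lower_semicontinuous:
  assumes "path \<gamma>" "t0 \<in> {0..1}"
  shows "y < curve_length \<gamma> 0 t0 \<Longrightarrow> \<forall>\<^sub>F t in at t0 within {0..1}. y < curve_length \<gamma> 0 t"
    and "y < curve_length \<gamma> t0 1 \<Longrightarrow> \<forall>\<^sub>F t in at t0 within {0..1}. y < curve_length \<gamma> t 1"
proof -
  have \<gamma>: "continuous_on {0..1} \<gamma>" using assms(1) by (simp add: path_def)
  {
    assume "y < curve_length \<gamma> 0 t0"
    then obtain ts where ts: "sorted ts" "set ts \<subseteq> {0..t0}" "y < ennreal (polygon_length \<gamma> ts)"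
      by (auto simp: curve_length_eq_SUP less_SUP_iff)
    let ?h = "\<lambda>t. polygon_length \<gamma> (map (\<lambda>\<tau>. min t \<tau>) ts)"
    have "continuous_on {0..1} ?h"
      using ts(2) assms(2) by (intro continuous_on_polygon_length[OF \<gamma>] continuous_intros) force+
    then have "(?h \<longlongrightarrow> ?h t0) (at t0 within {0..1})"
      using assms(2) by (simp add: continuous_on_def)
    moreover have "map (\<lambda>\<tau>. min t0 \<tau>) ts = ts"
      using ts(2) by (intro map_idI) force
    ultimately have "((\<lambda>t. ennreal (?h t)) \<longlongrightarrow> ennreal (polygon_length \<gamma> ts)) (at t0 within {0..1})"
      by (metis tendsto_ennrealI)
    then have "\<forall>\<^sub>F t in at t0 within {0..1}. y < ennreal (?h t)"
      using ts(3) by (rule order_tendstoD)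
    moreover have "\<forall>\<^sub>F t in at t0 within {0..1}. t \<in> {0..1}"
      by (simp add: eventually_at_filter)
    ultimately show "\<forall>\<^sub>F t in at t0 within {0..1}. y < curve_length \<gamma> 0 t"
    proof eventually_elim
      case (elim t)
      have "ennreal (?h t) \<le> curve_length \<gamma> 0 t"
        using ts elim
        by (intro polygon_length_le_curve_length)
           (force simp: sorted_map intro: sorted_wrt_mono_rel[OF _ ts(1)])+
      with elim show ?case by (metis order_less_le_trans)
    qed
  }
  {
    assume "y < curve_length \<gamma> t0 1"
    then obtain ts where ts: "sorted ts" "set ts \<subseteq> {t0..1}" "y < ennreal (polygon_length \<gamma> ts)"
      by (auto simp: curve_length_eq_SUP less_SUP_iff)
    let ?h = "\<lambda>t. polygon_length \<gamma> (map (\<lambda>\<tau>. max t \<tau>) ts)"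
    have "continuous_on {0..1} ?h"
      using ts(2) assms(2) by (intro continuous_on_polygon_length[OF \<gamma>] continuous_intros) force+
    then have "(?h \<longlongrightarrow> ?h t0) (at t0 within {0..1})"
      using assms(2) by (simp add: continuous_on_def)
    moreover have "map (\<lambda>\<tau>. max t0 \<tau>) ts = ts"
      using ts(2) by (intro map_idI) force
    ultimately have "((\<lambda>t. ennreal (?h t)) \<longlongrightarrow> ennreal (polygon_length \<gamma> ts)) (at t0 within {0..1})"
      by (metis tendsto_ennrealI)
    then have "\<forall>\<^sub>F t in at t0 within {0..1}. y < ennreal (?h t)"
      using ts(3) by (rule order_tendstoD)
    moreover have "\<forall>\<^sub>F t in at t0 within {0..1}. t \<in> {0..1}"
      by (simp add: eventually_at_filter)
    ultimately show "\<forall>\<^sub>F t in at t0 within {0..1}. y < curve_length \<gamma> t 1"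
    proof eventually_elim
      case (elim t)
      have "ennreal (?h t) \<le> curve_length \<gamma> t 1"
        using ts elim
        by (intro polygon_length_le_curve_length)
           (force simp: sorted_map intro: sorted_wrt_mono_rel[OF _ ts(1)])+
      with elim show ?case by (metis order_less_le_trans)
    qed
  }
qed

section \<open>The length function and the arc length parametrization of a rectifiable curve\<close>

locale rectifiable =
  fixes \<gamma> :: "real \<Rightarrow> 'a::metric_space"
  assumes rectifiable: "rectifiable_curve \<gamma>"
begin

definition len :: "real \<Rightarrow> real" where
  "len t = enn2real (curve_length \<gamma> 0 t)"

lemma curve_length_finite:
  assumes "0 \<le> a" "a \<le> b" "b \<le> 1"
  shows "curve_length \<gamma> a b < \<infinity>"
proof -
  have "curve_length \<gamma> 0 1 = curve_length \<gamma> 0 a + (curve_length \<gamma> a b + curve_length \<gamma> b 1)"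
    using assms by (simp add: curve_length_add[of 0 a 1] curve_length_add[of a b 1])
  then show ?thesis
    using rectifiable by (auto simp: rectifiable_curve_def)
qed

lemma ennreal_len: "t \<in> {0..1} \<Longrightarrow> ennreal (len t) = curve_length \<gamma> 0 t"
  using curve_length_finite[of 0 t] by (simp add: len_def)

lemma curve_length_eq_len_diff:
  assumes "0 \<le> a" "a \<le> b" "b \<le> 1"
  shows "len a \<le> len b" "curve_length \<gamma> a b = ennreal (len b - len a)"
proof -
  have "ennreal (len b) = ennreal (len a) + curve_length \<gamma> a b"
    using assms by (simp add: ennreal_len curve_length_add[of 0 a b])
  moreover obtain l where l: "curve_length \<gamma> a b = ennreal l" "0 \<le> l"
    using curve_length_finite[OF assms] by (cases "curve_length \<gamma> a b") auto
  ultimately have "len b = len a + l"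
    by (metis ennreal_plus ennreal_inj enn2real_nonneg len_def add_nonneg_nonneg)
  with l show "len a \<le> len b" "curve_length \<gamma> a b = ennreal (len b - len a)" by auto
qed

lemma dist_le_len_diff:
  assumes "a \<in> {0..1}" "b \<in> {0..1}"
  shows "dist (\<gamma> a) (\<gamma> b) \<le> \<bar>len a - len b\<bar>"
proof -
  have *: "dist (\<gamma> a) (\<gamma> b) \<le> len b - len a" if "0 \<le> a" "a \<le> b" "b \<le> 1" for a b
    using dist_le_curve_length[OF that(2), of \<gamma>] curve_length_eq_len_diff[OF that] by simp
  show ?thesis
    using *[of a b] *[of b a] assms by (cases "a \<le> b") (auto simp: dist_commute)
qed

lemma continuous_on_len: "continuous_on {0..1} len"
  unfolding continuous_on_def
proof (intro ballI order_tendstoI)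
  have "path \<gamma>" using rectifiable by (simp add: rectifiable_curve_def)
  note lsc = curve_length_lower_semicontinuous[OF this]
  have ev: "\<forall>\<^sub>F t in at t0 within {0..1}. t \<in> {0..1}" for t0 :: real
    by (simp add: eventually_at_filter)
  fix t0 :: real and a
  assume t0: "t0 \<in> {0..1}"
  {
    assume "a < len t0"
    show "\<forall>\<^sub>F t in at t0 within {0..1}. a < len t"
    proof (cases "0 \<le> a")
      case True
      with \<open>a < len t0\<close> t0 have "ennreal a < curve_length \<gamma> 0 t0"
        by (simp add: ennreal_len[symmetric] ennreal_lessI)
      from lsc(1)[OF t0 this] ev show ?thesis
      proof eventually_elim
        case (elim t)
        then show ?case using True by (simp add: ennreal_len[symmetric] ennreal_less_iff)
      qed
    next
      case False
      then show ?thesis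
        by (intro always_eventually) (auto simp: len_def intro: less_le_trans[OF _ enn2real_nonneg])
    qed
  }
  {
    assume "len t0 < a"
    show "\<forall>\<^sub>F t in at t0 within {0..1}. len t < a"
    \<comment> \<open>By additivity, \<open>len t < a\<close> says that the remaining length over
      \<open>[t, 1]\<close> exceeds \<open>len 1 - a\<close>, so lower semicontinuity of that length
      applies. If \<open>len 1 < a\<close>, monotonicity suffices.\<close>
    proof (cases "a \<le> len 1")
      case True
      have "ennreal (len 1 - a) < curve_length \<gamma> t0 1"
        using t0 True \<open>len t0 < a\<close> by (subst curve_length_eq_len_diff) (auto intro!: ennreal_lessI)
      from lsc(2)[OF t0 this] ev show ?thesis
      proof eventually_elim
        case (elim t)
        then have "ennreal (len 1 - a) < ennreal (len 1 - len t)"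
          by (metis curve_length_eq_len_diff(2) atLeastAtMost_iff order_refl)
        then show ?case using True by (simp add: ennreal_less_iff)
      qed
    next
      case False
      from ev show ?thesis
      proof eventually_elim
        case (elim t)
        then show ?case using False curve_length_eq_len_diff(1)[of t 1] by simp
      qed
    qed
  }
qed

text \<open>The choice operator may return another parameter \<open>t'\<close> of the same length,
  but then the distance of \<open>\<gamma> t'\<close> and \<open>\<gamma> t\<close> is at most
  \<open>\<bar>len t' - len t\<bar> = 0\<close>.\<close>

lemma arc_length_param_len:
  assumes "t \<in> {0..1}"
  shows "arc_length_param \<gamma> (len t) = \<gamma> t"
proof -
  define t' where "t' = (SOME t'. t' \<in> {0..1} \<and> curve_length \<gamma> 0 t' = ennreal (len t))"
  have "t' \<in> {0..1} \<and> curve_length \<gamma> 0 t' = ennreal (len t)"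
    unfolding t'_def by (rule someI[of _ t]) (use assms ennreal_len in auto)
  then have "t' \<in> {0..1}" "len t' = len t"
    by (auto simp: len_def)
  with dist_le_len_diff[OF this(1) assms] have "\<gamma> t' = \<gamma> t" by simp
  then show ?thesis by (simp add: arc_length_param_def t'_def)
qed

lemma len_0: "len 0 = 0"
  by (simp add: len_def curve_length_trivial)

lemma len_surj:
  assumes "s \<in> {0..len 1}"
  obtains t where "t \<in> {0..1}" "len t = s"
  using IVT'[of len 0 s 1] continuous_on_len assms len_0 by auto

lemma dist_arc_length_param_le:
  assumes "s \<in> {0..len 1}" "s' \<in> {0..len 1}"
  shows "dist (arc_length_param \<gamma> s) (arc_length_param \<gamma> s') \<le> \<bar>s - s'\<bar>"
  using len_surj[OF assms(1)] len_surj[OF assms(2)] arc_length_param_len dist_le_len_diff by metis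

lemma arc_length_param_ends:
  "arc_length_param \<gamma> 0 = \<gamma> 0" "arc_length_param \<gamma> (len 1) = \<gamma> 1"
  using arc_length_param_len[of 0] arc_length_param_len[of 1] len_0 by auto

lemma curve_integral_eq: "curve_integral \<gamma> g = (\<integral>\<^sup>+s\<in>{0..len 1}. g (arc_length_param \<gamma> s) \<partial>lborel)"
  by (simp add: curve_integral_def len_def)

end

section \<open>An upper gradient from a cover of the boundary\<close>

text \<open>The piecewise linear cutoff of a ball: for \<open>r > 0\<close> it is 1 on
  \<open>ball y r\<close>, 0 off \<open>ball y (2 * r)\<close>, and Lipschitz with constant
  \<open>1 / r\<close>.\<close>

fun bump :: "'a::metric_space \<times> real \<Rightarrow> 'a \<Rightarrow> real" where
  "bump (y, r) x = max 0 (min 1 (2 - dist x y / r))"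

lemma bump_bounds: "0 \<le> bump i x" "bump i x \<le> 1"
  by (cases i; simp)+

lemma bump_eq_1: "0 < r \<Longrightarrow> x \<in> ball y r \<Longrightarrow> bump (y, r) x = 1"
  by (auto simp: dist_commute field_simps max_def min_def)

lemma bump_pos_iff: "0 < r \<Longrightarrow> 0 < bump (y, r) x \<longleftrightarrow> x \<in> ball y (2 * r)"
  by (auto simp: dist_commute field_simps max_def min_def)

lemma bump_diff_le:
  assumes "0 < r"
  shows "bump (y, r) x \<le> bump (y, r) x' + dist x x' / r"
proof -
  have "dist x' y \<le> dist x y + dist x x'"
    by (metis add.commute dist_commute dist_triangle)
  then have "dist x' y / r \<le> dist x y / r + dist x x' / r"
    using assms by (simp add: field_simps)
  moreover have "0 \<le> dist x x' / r" using assms by simp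
  ultimately show ?thesis unfolding bump.simps by linarith
qed

lemma borel_measurable_bump [measurable]: "bump i \<in> borel_measurable borel"
proof -
  obtain y r where i: "i = (y, r)" by force
  have "continuous_on UNIV (bump i)"
    \<comment> \<open>For \<open>r = 0\<close> the quotient is 0 by convention and the bump is
      constantly 1.\<close>
    unfolding i bump.simps by (cases "r = 0") (auto intro!: continuous_intros)
  then show ?thesis by (rule borel_measurable_continuous_onI)
qed

text \<open>The function \<open>g\<close> is controlled only on the doubled ball, so the integral is
  restricted to a piece of the curve that starts at \<open>a\<close> and runs towards
  \<open>b\<close> while the bump is certainly positive. There \<open>g\<close> is at least
  \<open>1 / r\<close>, the Lipschitz constant of the bump.\<close>

lemma bump_le_integral:
  fixes c :: "real \<Rightarrow> 'a::metric_space"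
  assumes lip: "\<And>s s'. s \<in> {0..\<Lambda>} \<Longrightarrow> s' \<in> {0..\<Lambda>} \<Longrightarrow> dist (c s) (c s') \<le> \<bar>s - s'\<bar>"
    and ab: "a \<in> {0..\<Lambda>}" "b \<in> {0..\<Lambda>}"
    and r: "0 < r"
    and g: "\<And>s. s \<in> {0..\<Lambda>} \<Longrightarrow> c s \<in> ball y (2 * r) \<Longrightarrow> ennreal (1 / r) \<le> g (c s)"
  shows "ennreal (bump (y, r) (c a)) \<le> ennreal (bump (y, r) (c b)) + (\<integral>\<^sup>+s\<in>{0..\<Lambda>}. g (c s) \<partial>lborel)"
proof -
  define h where "h = (\<lambda>s. bump (y, r) (c s))"
  define l where "l = min \<bar>a - b\<bar> (r * h a)"
  \<comment> \<open>Half-open, because at the far end \<open>\<bar>a - s\<bar> < r * h a\<close> may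
    fail and the bump may vanish.\<close>
  define I where "I = (if a \<le> b then {a..<a + l} else {a - l<..a})"
  have h: "h s \<le> h s' + \<bar>s - s'\<bar> / r" if "s \<in> {0..\<Lambda>}" "s' \<in> {0..\<Lambda>}" for s s'
    using bump_diff_le[OF r, of y "c s" "c s'"] divide_right_mono[OF lip[OF that], of r] r
    unfolding h_def by linarith
  have "0 \<le> h a" unfolding h_def by (rule bump_bounds)
  then have l0: "0 \<le> l" unfolding l_def using r by simp
  have I: "I \<subseteq> {0..\<Lambda>}"
    using ab unfolding I_def l_def by auto
  have Ig: "ennreal (1 / r) \<le> g (c s)" if s: "s \<in> I" for s
  proof -
    have "\<bar>a - s\<bar> < r * h a"
      using s unfolding I_def l_def by (auto split: if_splits)
    then have "\<bar>a - s\<bar> / r < h a" using r by (simp add: field_simps)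
    then have "0 < h s" using h[of a s] ab I s by fastforce
    then show ?thesis
      using g[of s] I s bump_pos_iff[OF r, of y "c s"] by (auto simp: h_def)
  qed
  \<comment> \<open>Either the piece reaches \<open>b\<close> and the Lipschitz bound applies, or
    \<open>l / r\<close> equals \<open>h a\<close> and \<open>h b\<close> is nonnegative.\<close>
  have "h a \<le> h b + l / r"
  proof (cases "\<bar>a - b\<bar> \<le> r * h a")
    case True
    then show ?thesis using h[of a b] ab by (simp add: l_def min_def)
  next
    case False
    moreover have "0 \<le> h b" unfolding h_def by (rule bump_bounds)
    ultimately show ?thesis using r by (simp add: l_def min_def)
  qed
  then have "ennreal (h a) \<le> ennreal (h b) + ennreal (l / r)"
    using l0 r bump_bounds(1) by (simp add: h_def flip: ennreal_plus)
  also have "ennreal (l / r) = ennreal (1 / r) * emeasure lborel I"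
    using l0 r by (simp add: I_def flip: ennreal_mult)
  also have "\<dots> = (\<integral>\<^sup>+s. ennreal (1 / r) * indicator I s \<partial>lborel)"
    by (subst nn_integral_cmult_indicator) (auto simp: I_def)
  also have "\<dots> \<le> (\<integral>\<^sup>+s\<in>{0..\<Lambda>}. g (c s) \<partial>lborel)"
    using I Ig by (intro nn_integral_mono) (auto simp: indicator_def)
  finally show ?thesis by (simp add: h_def add_left_mono)
qed

text \<open>The supremum is taken in \<open>ennreal\<close>, where it exists for every cover and is
  0 for the empty one. It is at most 1, so \<open>enn2real\<close> loses nothing.\<close>

definition cover_fun :: "'a::metric_space set \<Rightarrow> ('a \<times> real) set \<Rightarrow> 'a \<Rightarrow> real" where
  "cover_fun \<Omega> \<C> x = enn2real (if x \<in> \<Omega> then 1 else (SUP i\<in>\<C>. ennreal (bump i x)))"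

text \<open>The value \<open>\<infinity>\<close> outside \<open>K\<close> takes care of curves leaving the region where the boundary is covered.\<close>

definition cover_gradient :: "real \<Rightarrow> 'a::metric_space set \<Rightarrow> ('a \<times> real) set \<Rightarrow> 'a \<Rightarrow> ennreal" where
  "cover_gradient p K \<C> x = (if x \<in> K
     then ennpowr (\<Sum>\<^sub>\<infinity>(y, r)\<in>\<C>. ennreal (r powr - p) * indicator (ball y (2 * r)) x) (1 / p)
     else \<infinity>)"

lemma SUP_bump_le_1: "(SUP i\<in>\<C>. ennreal (bump i x)) \<le> 1"
  by (auto intro!: SUP_least simp: bump_bounds ennreal_le_1)

lemma ennreal_cover_fun:
  "ennreal (cover_fun \<Omega> \<C> x) = (if x \<in> \<Omega> then 1 else (SUP i\<in>\<C>. ennreal (bump i x)))"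
proof -
  have "(SUP i\<in>\<C>. ennreal (bump i x)) < top"
    using SUP_bump_le_1[of x \<C>] by (rule order_le_less_trans) simp
  then show ?thesis by (simp add: cover_fun_def)
qed

lemma cover_fun_bounds: "0 \<le> cover_fun \<Omega> \<C> x" "cover_fun \<Omega> \<C> x \<le> 1"
proof -
  have "ennreal (cover_fun \<Omega> \<C> x) \<le> ennreal 1"
    unfolding ennreal_cover_fun using SUP_bump_le_1[of x \<C>] by simp
  then show "cover_fun \<Omega> \<C> x \<le> 1" by (simp add: ennreal_le_1)
qed (simp add: cover_fun_def)

lemma cover_fun_eq_1: "x \<in> \<Omega> \<Longrightarrow> cover_fun \<Omega> \<C> x = 1"
  by (simp add: cover_fun_def)

lemma cover_fun_eq_0:
  assumes "x \<notin> \<Omega>" "\<And>y r. (y, r) \<in> \<C> \<Longrightarrow> 0 < r \<and> x \<notin> ball y (2 * r)"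
  shows "cover_fun \<Omega> \<C> x = 0"
proof -
  have "bump i x = 0" if "i \<in> \<C>" for i
    using assms(2)[of "fst i" "snd i"] that bump_pos_iff[of "snd i" "fst i" x] bump_bounds(1)[of i x]
    by (auto simp del: bump.simps)
  then show ?thesis using assms(1) by (simp add: cover_fun_def image_constant_conv bot_ennreal)
qed

lemma borel_measurable_cover_fun:
  assumes "countable \<C>" "open \<Omega>"
  shows "cover_fun \<Omega> \<C> \<in> borel_measurable borel"
proof -
  have [measurable]: "(\<lambda>x. SUP i\<in>\<C>. ennreal (bump i x)) \<in> borel_measurable borel"
    using assms(1) by (intro borel_measurable_SUP) auto
  have [measurable]: "\<Omega> \<in> sets borel" using assms(2) by simp
  show ?thesis unfolding cover_fun_def by measurable
qed

lemma borel_measurable_cover_gradient: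
  assumes "countable \<C>" "closed K"
  shows "cover_gradient p K \<C> \<in> borel_measurable borel"
proof -
  have [measurable]: "(\<lambda>x. \<Sum>\<^sub>\<infinity>(y, r)\<in>\<C>. ennreal (r powr - p) * indicator (ball y (2 * r)) x)
      \<in> borel_measurable borel"
    unfolding case_prod_beta
  proof (rule borel_measurable_infsum_ennreal[OF assms(1)])
    fix i :: "'a \<times> real"
    have [measurable]: "ball (fst i) (2 * snd i) \<in> sets borel" by simp
    show "(\<lambda>x. ennreal (snd i powr - p) * indicator (ball (fst i) (2 * snd i)) x) \<in> borel_measurable borel"
      by measurable
  qed
  have [measurable]: "K \<in> sets borel" using assms(2) by simp
  show ?thesis unfolding cover_gradient_def by measurable
qed

text \<open>A single term of the sum suffices, since the \<open>1 / p\<close>-th power of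
  \<open>r powr - p\<close> is \<open>1 / r\<close>.\<close>

lemma cover_gradient_ge:
  assumes "(y, r) \<in> \<C>" "0 < r" "0 < p" "x \<in> ball y (2 * r)"
  shows "ennreal (1 / r) \<le> cover_gradient p K \<C> x"
proof (cases "x \<in> K")
  case True
  have "ennreal (1 / r) = ennpowr (ennreal (r powr - p)) (1 / p)"
    using assms powr_powr[of r "- p" "1 / p"] powr_minus_divide[of r 1]
    by (simp add: ennpowr_def del: powr_powr)
  also have "\<dots> = ennpowr (\<Sum>(y, r)\<in>{(y, r)}. ennreal (r powr - p) * indicator (ball y (2 * r)) x) (1 / p)"
    using assms(4) by simp
  also have "\<dots> \<le> cover_gradient p K \<C> x"
    unfolding cover_gradient_def using True assms(1,3)
    by (simp only: if_True, intro ennpowr_mono finite_sum_le_infsum_ennreal) auto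
  finally show ?thesis .
qed (simp add: cover_gradient_def)

text \<open>Inside \<open>K\<close> a curve can pass from \<open>\<Omega>\<close> to its complement
  only through a covering ball, where the bump is already 1; afterwards the integral pays for the
  decay of this bump. A nonconstant curve that leaves \<open>K\<close> has infinite
  integral.\<close>

lemma upper_gradient_cover_fun:
  fixes \<Omega> K :: "'a::metric_space set"
  assumes "countable \<C>" "open \<Omega>" "closed K" "0 < p"
    and pos: "\<And>y r. (y, r) \<in> \<C> \<Longrightarrow> 0 < r"
    and cover: "frontier \<Omega> \<inter> K \<subseteq> (\<Union>(y, r)\<in>\<C>. ball y r)"
  shows "upper_gradient (cover_fun \<Omega> \<C>) (cover_gradient p K \<C>)"
  unfolding upper_gradient_def
proof (intro conjI allI impI)
  show "cover_gradient p K \<C> \<in> borel_measurable borel"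
    using assms by (intro borel_measurable_cover_gradient)
next
  fix \<gamma> :: "real \<Rightarrow> 'a"
  assume "rectifiable_curve \<gamma>"
  then interpret rectifiable \<gamma> by unfold_locales
  define \<Lambda> where "\<Lambda> = len 1"
  define c where "c = arc_length_param \<gamma>"
  define u where "u = cover_fun \<Omega> \<C>"
  define g where "g = cover_gradient p K \<C>"
  define J where "J = curve_integral \<gamma> g"
  have J: "J = (\<integral>\<^sup>+s\<in>{0..\<Lambda>}. g (c s) \<partial>lborel)"
    unfolding J_def c_def \<Lambda>_def by (rule curve_integral_eq)
  have \<Lambda>: "0 \<le> \<Lambda>" unfolding \<Lambda>_def len_def by simp
  have lip: "dist (c s) (c s') \<le> \<bar>s - s'\<bar>" if "s \<in> {0..\<Lambda>}" "s' \<in> {0..\<Lambda>}" for s s'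
    using dist_arc_length_param_le that unfolding c_def \<Lambda>_def by blast
  have cont: "continuous_on {0..\<Lambda>} c"
    unfolding continuous_on_iff using lip by (metis dist_commute dist_real_def order_le_less_trans)
  have ends: "c 0 = \<gamma> 0" "c \<Lambda> = \<gamma> 1"
    using arc_length_param_ends unfolding c_def \<Lambda>_def by auto
  have bump_le: "ennreal (bump (y, r) (c a)) \<le> ennreal (bump (y, r) (c b)) + J"
    if "a \<in> {0..\<Lambda>}" "b \<in> {0..\<Lambda>}" "(y, r) \<in> \<C>" for a b y r
    unfolding J using that pos \<open>0 < p\<close> cover_gradient_ge[of y r \<C> p _ K]
    by (intro bump_le_integral lip) (auto simp: g_def)
  show "ennreal \<bar>cover_fun \<Omega> \<C> (\<gamma> 0) - cover_fun \<Omega> \<C> (\<gamma> 1)\<bar> \<le> curve_integral \<gamma> (cover_gradient p K \<C>)"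
  proof (cases "c ` {0..\<Lambda>} \<subseteq> K")
    case True
    \<comment> \<open>The parameters \<open>a\<close> and \<open>b\<close> may come in either order,
      so this one-sided estimate also bounds the absolute difference.\<close>
    have le: "ennreal (u (c a)) \<le> ennreal (u (c b)) + J"
      if ab: "a \<in> {0..\<Lambda>}" "b \<in> {0..\<Lambda>}" for a b
    proof (cases "c b \<in> \<Omega>")
      case True
      then have "u (c a) \<le> u (c b)"
        using cover_fun_bounds(2)[of \<Omega> \<C> "c a"] by (simp add: u_def cover_fun_eq_1)
      then have "ennreal (u (c a)) \<le> ennreal (u (c b))" by (rule ennreal_leI)
      then show ?thesis by (rule order_trans) simp
    next
      case b: False
      have bb: "ennreal (bump (y, r) (c b)) \<le> ennreal (u (c b))" if "(y, r) \<in> \<C>" for y r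
        unfolding u_def ennreal_cover_fun using b that by (auto intro!: SUP_upper2[of "(y, r)"] simp del: bump.simps)
      show ?thesis
      proof (cases "c a \<in> \<Omega>")
        case a: True
        have "connected (c ` closed_segment a b)"
          using ab by (intro connected_continuous_image continuous_on_subset[OF cont])
            (auto simp: closed_segment_eq_real_ivl)
        then have "c ` closed_segment a b \<inter> frontier \<Omega> \<noteq> {}"
          using a b by (intro connected_Int_frontier) auto
        \<comment> \<open>The crossing point of the frontier: some bump equals 1 there, which is the
          value of \<open>u\<close> at \<open>c a\<close>.\<close>
        then obtain s where s: "s \<in> closed_segment a b" "c s \<in> frontier \<Omega>" by auto
        then have s0: "s \<in> {0..\<Lambda>}" using ab by (auto simp: closed_segment_eq_real_ivl split: if_splits)
        with s(2) \<open>c ` {0..\<Lambda>} \<subseteq> K\<close> cover have "c s \<in> (\<Union>(y, r)\<in>\<C>. ball y r)"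
          by blast
        then obtain y r where i: "(y, r) \<in> \<C>" "c s \<in> ball y r" by blast
        have "ennreal (u (c a)) = ennreal (bump (y, r) (c s))"
          using a i pos by (simp add: bump_eq_1 u_def cover_fun_eq_1 del: bump.simps)
        also have "\<dots> \<le> ennreal (u (c b)) + J"
          using bump_le[OF s0 ab(2) i(1)] bb[OF i(1)] by (meson add_right_mono order_trans)
        finally show ?thesis .
      next
        case a: False
        have "ennreal (u (c a)) = (SUP i\<in>\<C>. ennreal (bump i (c a)))"
          using a by (simp add: u_def ennreal_cover_fun)
        also have "\<dots> \<le> ennreal (u (c b)) + J"
          using bump_le[OF ab] bb by (intro SUP_least) (metis add_right_mono order_trans surj_pair)
        finally show ?thesis .
      qed
    qed
    have diff: "ennreal (u x - u x') \<le> J" if "ennreal (u x) \<le> ennreal (u x') + J" for x x'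
    proof (cases J)
      case (real j)
      then have "u x \<le> u x' + j"
        using that cover_fun_bounds(1)[of \<Omega> \<C> x'] by (simp add: u_def flip: ennreal_plus)
      then show ?thesis using real by (simp add: ennreal_leI)
    qed simp
    have "ennreal (u (c 0) - u (c \<Lambda>)) \<le> J" "ennreal (u (c \<Lambda>) - u (c 0)) \<le> J"
      using le \<Lambda> by (auto intro!: diff)
    then show ?thesis
      unfolding u_def[symmetric] ends J_def g_def[symmetric] by (auto simp: abs_if)
  next
    case False
    then obtain s where s: "s \<in> {0..\<Lambda>}" "c s \<notin> K" by blast
    show ?thesis
    \<comment> \<open>A curve of length 0 has a vanishing integral even where \<open>g\<close> is
      infinite, but its end points coincide.\<close>
    proof (cases "\<Lambda> = 0")
      case True
      then show ?thesis using ends by simp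
    next
      case False
      obtain e where e: "0 < e" "ball (c s) e \<subseteq> - K"
        using s \<open>closed K\<close> by (metis ComplI open_Compl open_contains_ball_eq)
      \<comment> \<open>The parametrization is 1-Lipschitz, so the curve stays in the open
        complement of \<open>K\<close> on a whole parameter interval of positive length.\<close>
      define a b where "a = max 0 (s - e)" and "b = min \<Lambda> (s + e)"
      have ab: "a < b" using s(1) e(1) \<Lambda> False by (auto simp: a_def b_def)
      have inf: "g (c t) = \<infinity>" if "t \<in> {a<..<b}" for t
      proof -
        have "t \<in> {0..\<Lambda>}" "\<bar>s - t\<bar> < e" using that by (auto simp: a_def b_def)
        then have "c t \<in> ball (c s) e" using lip[OF s(1), of t] by simp
        then show ?thesis using e by (auto simp: g_def cover_gradient_def)
      qed
      have "\<infinity> = (\<integral>\<^sup>+t. \<infinity> * indicator {a<..<b} t \<partial>lborel)"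
        using ab by (subst nn_integral_cmult_indicator) (auto simp: ennreal_top_mult)
      also have "\<dots> \<le> (\<integral>\<^sup>+t\<in>{0..\<Lambda>}. g (c t) \<partial>lborel)"
        using inf by (intro nn_integral_mono) (auto simp: indicator_def a_def b_def)
      finally show ?thesis unfolding J[symmetric] by (simp add: J_def g_def top_unique)
    qed
  qed
qed

section \<open>Consequences of the Poincare inequality\<close>

text \<open>The structural constants are parameters, so that the constants of later lemmas can be
  chosen before the open set, the cover and the scale.\<close>

locale poincare_space =
  fixes M :: "'a::metric_space measure" and D C L p :: real
  assumes sets_M: "sets M = sets borel"
    and doubling_const_ge_1: "1 \<le> D"
    and doubling_raw: "\<And>x r. 0 < r \<Longrightarrow> 0 < emeasure M (ball x (2 * r)) \<and>
          emeasure M (ball x (2 * r)) \<le> ennreal D * emeasure M (ball x r) \<and>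
          ennreal D * emeasure M (ball x r) < \<infinity>"
    and p_ge_1: "1 \<le> p" and C_ge_1: "1 \<le> C" and L_ge_1: "1 \<le> L"
    and poincare: "\<And>f g x r. locally_integrable M f \<Longrightarrow> upper_gradient f g \<Longrightarrow> 0 < r \<Longrightarrow>
          nn_average M (ball x r) (\<lambda>y. ennreal \<bar>f y - average M (ball x r) f\<bar>)
            \<le> ennreal (C * r) *
               ennpowr (nn_average M (ball x (L * r)) (\<lambda>y. ennpowr (g y) p)) (1 / p)"
begin

section \<open>Measures of balls under the doubling condition\<close>

lemma open_sets_M [measurable]: "open U \<Longrightarrow> U \<in> sets M"
  by (simp add: sets_M)

lemma emeasure_ball_finite: "emeasure M (ball x r) < \<infinity>"
proof (cases "0 < r")
  case True
  have "emeasure M (ball x r) \<le> ennreal D * emeasure M (ball x r)"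
    using mult_right_mono[of 1 "ennreal D" "emeasure M (ball x r)"] doubling_const_ge_1
    by simp
  then show ?thesis using doubling_raw[OF True, of x] by (metis order_le_less_trans)
qed (simp add: ball_empty)

lemma emeasure_ball: "emeasure M (ball x r) = ennreal (measure M (ball x r))"
  using emeasure_ball_finite[of x r] by (intro emeasure_eq_ennreal_measure) auto

lemma emeasure_finite_sub_ball: "A \<subseteq> ball x r \<Longrightarrow> emeasure M A = ennreal (measure M A)"
  using emeasure_mono[of A "ball x r" M] emeasure_ball_finite[of x r]
  by (intro emeasure_eq_ennreal_measure) (auto simp: top_unique)

lemma fmeasurable_sub_ball: "A \<in> sets borel \<Longrightarrow> A \<subseteq> ball x r \<Longrightarrow> A \<in> fmeasurable M"
  using emeasure_finite_sub_ball[of A x r] by (intro fmeasurableI) (auto simp: sets_M)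

lemma measure_ball_pos: "0 < r \<Longrightarrow> 0 < measure M (ball x r)"
  using doubling_raw[of "r / 2" x] by (simp add: emeasure_ball)

lemma measure_mono_ball: "A \<in> sets borel \<Longrightarrow> A \<subseteq> B \<Longrightarrow> B \<in> sets borel \<Longrightarrow> B \<subseteq> ball x r \<Longrightarrow> measure M A \<le> measure M B"
  by (intro measure_mono_fmeasurable fmeasurable_sub_ball) (auto simp: sets_M)

lemma measure_ball_mono: "ball x r \<subseteq> ball y s \<Longrightarrow> measure M (ball x r) \<le> measure M (ball y s)"
  by (rule measure_mono_ball[of _ _ y s]) auto

lemma measure_ball_double: "measure M (ball x (2 * r)) \<le> D * measure M (ball x r)"
proof (cases "0 < r")
  case True
  from doubling_raw[OF this, of x] show ?thesis
    using doubling_const_ge_1 by (simp add: emeasure_ball flip: ennreal_mult)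
qed (simp add: ball_empty)

lemma measure_ball_power: "measure M (ball x (2 ^ n * r)) \<le> D ^ n * measure M (ball x r)"
proof (induction n)
  case (Suc n)
  have "measure M (ball x (2 ^ Suc n * r)) \<le> D * measure M (ball x (2 ^ n * r))"
    using measure_ball_double[of x "2 ^ n * r"] by (simp add: mult.assoc)
  also have "\<dots> \<le> D * (D ^ n * measure M (ball x r))"
    using Suc doubling_const_ge_1 by (intro mult_left_mono) auto
  finally show ?case by (simp add: mult.assoc)
qed simp

text \<open>The ball around \<open>y\<close> lies in the ball around \<open>x\<close> of radius
  \<open>2 * T * s\<close>, and finitely many doublings of \<open>s\<close> exceed this
  radius.\<close>

lemma measure_ball_comparable:
  "\<exists>c\<ge>1. \<forall>x y s t. 0 < s \<longrightarrow> t \<le> T * s \<longrightarrow> dist x y \<le> T * s \<longrightarrow>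
    measure M (ball y t) \<le> c * measure M (ball x s)"
proof -
  obtain n where n: "2 * T < 2 ^ n" using real_arch_pow[of 2 "2 * T"] by auto
  show ?thesis
  proof (intro exI conjI allI impI)
    show "1 \<le> D ^ n" using doubling_const_ge_1 by simp
    fix x y :: 'a and s t :: real
    assume *: "0 < s" "t \<le> T * s" "dist x y \<le> T * s"
    have "dist x y + t \<le> 2 ^ n * s"
      using * mult_strict_right_mono[OF n *(1)] by linarith
    then have "ball y t \<subseteq> ball x (2 ^ n * s)"
      by (auto simp: subset_iff) (metis add.commute add_less_cancel_left dist_triangle le_less_trans order_less_le_trans)
    then have "measure M (ball y t) \<le> measure M (ball x (2 ^ n * s))"
      by (rule measure_ball_mono)
    also have "\<dots> \<le> D ^ n * measure M (ball x s)" by (rule measure_ball_power)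
    finally show "measure M (ball y t) \<le> D ^ n * measure M (ball x s)" .
  qed
qed

lemma measure_open_pos:
  assumes "open U" "U \<noteq> {}" "U \<subseteq> ball x r"
  shows "0 < measure M U"
proof -
  obtain y e where y: "0 < e" "ball y e \<subseteq> U"
    using assms(1,2) by (meson ex_in_conv open_contains_ball)
  have "0 < measure M (ball y e)" by (rule measure_ball_pos[OF y(1)])
  also have "\<dots> \<le> measure M U"
    using y assms by (intro measure_mono_ball[of _ _ x r]) auto
  finally show ?thesis .
qed

section \<open>The Poincare inequality for cutoff functions, and scales at which both sides have
  positive density\<close>

lemma locally_integrable_bounded:
  assumes "f \<in> borel_measurable borel" "\<And>x. \<bar>f x\<bar> \<le> b"
  shows "locally_integrable M f"
  unfolding locally_integrable_def
proof (intro allI exI conjI)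
  fix x
  have f: "f \<in> borel_measurable M" using assms(1) sets_M by (metis measurable_cong_sets)
  have "integrable M (\<lambda>y. indicator (ball x 1) y *\<^sub>R f y)"
    using assms(2) f emeasure_ball_finite
    by (intro integrableI_bounded_set_indicator[where B = b]) auto
  then show "set_integrable (completion M) (ball x 1) f"
    unfolding set_integrable_def using f by (subst integrable_completion) auto
qed simp

text \<open>A Chebyshev-type bound: only the contribution of \<open>E\<close> to the average is
  kept.\<close>

lemma nn_average_ge:
  assumes "0 < s" "E \<in> sets borel" "E \<subseteq> ball z s"
    and "c * measure M (ball z s) \<le> measure M E" "0 \<le> c" "0 \<le> b"
    and "\<And>x. x \<in> E \<Longrightarrow> b \<le> h x"
  shows "ennreal (b * c) \<le> nn_average M (ball z s) (\<lambda>x. ennreal (h x))"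
proof -
  let ?m = "measure M (ball z s)"
  have "ennreal (b * c * ?m) \<le> ennreal b * ennreal (measure M E)"
    using assms(4-6) by (simp add: mult.assoc ennreal_leI mult_left_mono flip: ennreal_mult)
  also have "\<dots> = (\<integral>\<^sup>+x. ennreal b * indicator E x \<partial>M)"
    using assms(2,3) by (simp add: nn_integral_cmult_indicator sets_M emeasure_finite_sub_ball)
  also have "\<dots> \<le> (\<integral>\<^sup>+x\<in>ball z s. ennreal (h x) \<partial>M)"
    using assms(3,7) by (intro nn_integral_mono) (auto simp: indicator_def intro: ennreal_leI)
  finally have "ennreal (b * c * ?m) / ennreal ?m \<le> nn_average M (ball z s) (\<lambda>x. ennreal (h x))"
    unfolding nn_average_def nn_integral_completion emeasure_ball by (rule divide_right_mono_ennreal)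
  moreover have "ennreal (b * c * ?m) / ennreal ?m = ennreal (b * c)"
    using measure_ball_pos[OF assms(1), of z] assms(5,6) by (simp add: divide_ennreal)
  ultimately show ?thesis by simp
qed

text \<open>The cover function is 1 on \<open>\<Omega>\<close> and 0 outside \<open>\<Omega>\<close>
  and the doubled balls. Both regions are substantial, so its mean oscillation is at least
  \<open>c / 2\<close>, while the \<open>p\<close>-th power of its gradient integrates to at most
  the sum on the right.\<close>

lemma poincare_cover:
  assumes "open \<Omega>" "countable \<C>" "0 < s" "0 < c"
    and pos: "\<And>y r. (y, r) \<in> \<C> \<Longrightarrow> 0 < r"
    and cover: "frontier \<Omega> \<inter> cball z (L * s) \<subseteq> (\<Union>(y, r)\<in>\<C>. ball y r)"
    and in1: "c * measure M (ball z s) \<le> measure M (ball z s \<inter> \<Omega>)"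
    and in0: "c * measure M (ball z s) \<le> measure M (ball z s - \<Omega> - (\<Union>(y, r)\<in>\<C>. ball y (2 * r)))"
  shows "ennreal ((c / (2 * C * s)) powr p * measure M (ball z s))
    \<le> (\<Sum>\<^sub>\<infinity>(y, r)\<in>\<C>. ennreal (r powr - p * measure M (ball y (2 * r))))"
    (is "_ \<le> ?W")
proof -
  define u where "u = cover_fun \<Omega> \<C>"
  \<comment> \<open>This set is closed and contains the ball over which \<open>g\<close> is
    averaged, so the value infinity never enters the average.\<close>
  define g where "g = cover_gradient p (cball z (L * s)) \<C>"
  define m where "m = average M (ball z s) u"
  define N where "N = measure M (ball z (L * s))"
  have "0 < p" using p_ge_1 by simp
  have "\<bar>u x\<bar> \<le> 1" for x
    using cover_fun_bounds[of \<Omega> \<C> x] by (simp add: u_def)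
  moreover have "u \<in> borel_measurable borel"
    unfolding u_def using assms(1,2) by (intro borel_measurable_cover_fun)
  ultimately have "locally_integrable M u"
    by (intro locally_integrable_bounded[where b = 1])
  moreover have "upper_gradient u g"
    unfolding u_def g_def using assms \<open>0 < p\<close> by (intro upper_gradient_cover_fun) auto
  ultimately have PI: "nn_average M (ball z s) (\<lambda>y. ennreal \<bar>u y - m\<bar>)
      \<le> ennreal (C * s) * ennpowr (nn_average M (ball z (L * s)) (\<lambda>y. ennpowr (g y) p)) (1 / p)"
    unfolding m_def using \<open>0 < s\<close> by (intro poincare)
  have lower: "ennreal (1 / 2 * c) \<le> nn_average M (ball z s) (\<lambda>y. ennreal \<bar>u y - m\<bar>)"
  \<comment> \<open>The mean is at distance at least 1/2 from one of the values 1 and 0, whichever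
    it is.\<close>
  proof (cases "m \<le> 1 / 2")
    case True
    show ?thesis
      by (rule nn_average_ge[where E = "ball z s \<inter> \<Omega>"])
         (use in1 assms True in \<open>auto simp: u_def cover_fun_eq_1\<close>)
  next
    case False
    have op: "open (\<Union>(y, r)\<in>\<C>. ball y (2 * r))" by auto
    show ?thesis
    proof (rule nn_average_ge[where E = "ball z s - \<Omega> - (\<Union>(y, r)\<in>\<C>. ball y (2 * r))"])
      fix x assume "x \<in> ball z s - \<Omega> - (\<Union>(y, r)\<in>\<C>. ball y (2 * r))"
      then have "u x = 0"
        unfolding u_def using pos by (intro cover_fun_eq_0) fastforce+
      then show "1 / 2 \<le> \<bar>u x - m\<bar>" using False by simp
    qed (use in0 assms op in auto)
  qed
  \<comment> \<open>The average of \<open>g\<close> has the larger measure \<open>N\<close> in its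
    denominator; monotonicity later replaces \<open>N\<close> by the measure of
    \<open>ball z s\<close>.\<close>
  have N: "0 < N" "measure M (ball z s) \<le> N"
    unfolding N_def using \<open>0 < s\<close> L_ge_1 mult_right_mono[of 1 L s]
    by (auto intro!: measure_ball_pos measure_ball_mono subset_ball)
  have "(\<integral>\<^sup>+x\<in>ball z (L * s). ennpowr (g x) p \<partial>M)
      \<le> (\<integral>\<^sup>+x. (\<Sum>\<^sub>\<infinity>(y, r)\<in>\<C>. ennreal (r powr - p) * indicator (ball y (2 * r)) x) \<partial>M)"
    using \<open>0 < p\<close>
    by (intro nn_integral_mono)
       (auto simp: g_def cover_gradient_def ennpowr_ennpowr_inverse indicator_def less_imp_le)
  also have "\<dots> = (\<Sum>\<^sub>\<infinity>i\<in>\<C>. \<integral>\<^sup>+x. ennreal (snd i powr - p) * indicator (ball (fst i) (2 * snd i)) x \<partial>M)"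
    unfolding case_prod_beta using assms(2) by (intro nn_integral_infsum_ennreal) auto
  also have "\<dots> = ?W"
    unfolding case_prod_beta
    by (intro infsum_cong) (simp add: nn_integral_cmult_indicator emeasure_ball ennreal_mult)
  finally have g_le: "nn_average M (ball z (L * s)) (\<lambda>y. ennpowr (g y) p) \<le> ?W / ennreal N"
    unfolding nn_average_def nn_integral_completion emeasure_ball N_def
    by (rule divide_right_mono_ennreal)
  have main: "ennreal (1 / 2 * c) \<le> ennreal (C * s) * ennpowr (?W / ennreal N) (1 / p)"
    using lower PI mult_left_mono[OF ennpowr_mono[OF _ g_le, of "1 / p"], of "ennreal (C * s)"] \<open>0 < p\<close>
    by (meson divide_pos_pos order_trans zero_le zero_less_one)
  show ?thesis
  proof (cases ?W)
    case (real w)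
    have Cs: "0 < C * s" using C_ge_1 \<open>0 < s\<close> by simp
    have "ennreal (1 / 2 * c) \<le> ennreal (C * s * (w / N) powr (1 / p))"
      using main Cs N real by (simp add: divide_ennreal ennpowr_def ennreal_mult)
    then have "1 / 2 * c \<le> C * s * (w / N) powr (1 / p)"
      using Cs by (subst (asm) ennreal_le_iff) auto
    then have "c / (2 * C * s) \<le> (w / N) powr (1 / p)"
      using Cs by (simp add: field_simps)
    then have "(c / (2 * C * s)) powr p \<le> ((w / N) powr (1 / p)) powr p"
      using \<open>0 < p\<close> \<open>0 < c\<close> Cs \<open>0 < s\<close> C_ge_1 by (intro powr_mono2) auto
    also have "\<dots> = w / N"
      using \<open>0 < p\<close> N real by (simp add: powr_powr)
    finally have "(c / (2 * C * s)) powr p * N \<le> w"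
      using N by (simp add: field_simps)
    moreover have "(c / (2 * C * s)) powr p * measure M (ball z s) \<le> (c / (2 * C * s)) powr p * N"
      using N by (intro mult_left_mono) auto
    ultimately show ?thesis using real by (simp add: ennreal_leI)
  qed simp
qed

text \<open>A ball need not be connected, so avoiding the frontier does not by itself put it inside
  \<open>\<Omega>\<close>. Without frontier in the \<open>L\<close>-fold ball the empty cover is
  admissible; if the ball also met the complement, a positive quantity would be bounded by the empty
  sum.\<close>

lemma ball_subset_if_frontier_free:
  fixes \<Omega> :: "'a set"
  assumes "open \<Omega>" "x \<in> \<Omega>" "0 < s" "frontier \<Omega> \<inter> cball x (L * s) = {}"
  shows "ball x s \<subseteq> \<Omega>"
proof (rule ccontr)
  assume notsub: "\<not> ball x s \<subseteq> \<Omega>"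
  have "s \<le> L * s" using L_ge_1 \<open>0 < s\<close> by simp
  then have "ball x s \<inter> frontier \<Omega> = {}" using assms(4) by auto
  then have eq: "ball x s - \<Omega> = ball x s - closure \<Omega>"
    using assms(1) closure_subset[of \<Omega>] by (auto simp: frontier_def interior_open)
  \<comment> \<open>Any positive density serves, so the actual proportions of the two sides are
    taken. Both are positive because both sides are open and nonempty in the ball.\<close>
  define c where "c = min (measure M (ball x s \<inter> \<Omega>)) (measure M (ball x s - \<Omega>)) / measure M (ball x s)"
  have B: "0 < measure M (ball x s)" by (rule measure_ball_pos[OF \<open>0 < s\<close>])
  have "0 < measure M (ball x s \<inter> \<Omega>)"
    using assms centre_in_ball[of x s] by (intro measure_open_pos[of _ x s]) blast+
  moreover have "0 < measure M (ball x s - \<Omega>)"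
  proof (rule measure_open_pos)
    show "open (ball x s - \<Omega>)" unfolding eq by auto
  qed (use notsub in auto)
  ultimately have c: "0 < c" using B by (simp add: c_def)
  have "ennreal ((c / (2 * C * s)) powr p * measure M (ball x s))
    \<le> (\<Sum>\<^sub>\<infinity>(y, r)\<in>({} :: ('a \<times> real) set). ennreal (r powr - p * measure M (ball y (2 * r))))"
    using assms B c by (intro poincare_cover[of \<Omega>]) (auto simp: c_def)
  moreover have "0 < (c / (2 * C * s)) powr p * measure M (ball x s)"
    using c C_ge_1 \<open>0 < s\<close> B by simp
  ultimately show False by (simp add: ennreal_eq_0_iff)
qed

text \<open>The radius is halved from \<open>S\<close> until the density of \<open>\<Omega>\<close>
  falls below \<open>c\<close>. At the last step before the drop \<open>\<Omega>\<close> still has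
  density \<open>c\<close>, while half of the next smaller ball lies in the complement; passing back
  to the larger ball costs the factor \<open>D\<close>.\<close>

lemma intermediate_scale:
  assumes "open \<Omega>" "z \<notin> closure \<Omega>" "0 < S" "0 < c" "c \<le> 1 / 2"
    and "c * measure M (ball z S) \<le> measure M (ball z S \<inter> \<Omega>)"
  obtains s where "0 < s" "s \<le> S" "c * measure M (ball z s) \<le> measure M (ball z s \<inter> \<Omega>)"
    "1 / (2 * D) * measure M (ball z s) \<le> measure M (ball z s - \<Omega>)"
proof -
  define sc where "sc k = S / 2 ^ k" for k :: nat
  have sc: "0 < sc k" "sc k \<le> S" for k
    using \<open>0 < S\<close> by (auto simp: sc_def divide_le_eq mult_ge1_I)
  define P where "P k \<longleftrightarrow> measure M (ball z (sc k) \<inter> \<Omega>) < c * measure M (ball z (sc k))" for k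
  have "\<exists>k. P k"
  \<comment> \<open>A ball around \<open>z\<close> misses \<open>\<Omega>\<close>, so the density is
    0 at small scales.\<close>
  proof -
    obtain e where e: "0 < e" "ball z e \<subseteq> - closure \<Omega>"
      using assms(2) by (metis ComplI open_Compl closed_closure open_contains_ball_eq)
    obtain k :: nat where k: "S / e < 2 ^ k" using real_arch_pow[of 2 "S / e"] by auto
    then have "sc k \<le> e" using e by (simp add: sc_def field_simps)
    then have "ball z (sc k) \<inter> \<Omega> = {}"
      using e closure_subset[of \<Omega>] subset_ball[of "sc k" e z] by blast
    then show ?thesis
      using measure_ball_pos[OF sc(1)] \<open>0 < c\<close> by (intro exI[of _ k]) (simp add: P_def)
  qed
  moreover have "\<not> P 0" using assms(6) by (simp add: P_def sc_def)
  ultimately obtain k where k: "\<not> P k" "P (Suc k)"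
    by (metis (full_types) nat.exhaust exists_least_lemma)
  show ?thesis
  proof (rule that[of "sc k"])
    show "0 < sc k" "sc k \<le> S" by (rule sc)+
    show "c * measure M (ball z (sc k)) \<le> measure M (ball z (sc k) \<inter> \<Omega>)"
      using k(1) by (simp add: P_def)
    let ?B = "ball z (sc (Suc k))"
    have half: "sc k = 2 * sc (Suc k)" by (simp add: sc_def)
    have "measure M ?B \<le> measure M (?B \<inter> \<Omega>) + measure M (?B - \<Omega>)"
    proof -
      have "measure M ?B = measure M ((?B \<inter> \<Omega>) \<union> (?B - \<Omega>))" by (simp add: Int_Diff_Un)
      also have "\<dots> \<le> measure M (?B \<inter> \<Omega>) + measure M (?B - \<Omega>)"
        using assms(1) by (intro measure_Un_le) (auto simp: sets_M)
      finally show ?thesis .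
    qed
    moreover have "measure M (?B \<inter> \<Omega>) \<le> 1 / 2 * measure M ?B"
      using k(2) mult_right_mono[OF assms(5), of "measure M ?B"] by (simp add: P_def)
    ultimately have "1 / 2 * measure M ?B \<le> measure M (?B - \<Omega>)" by simp
    also have "\<dots> \<le> measure M (ball z (sc k) - \<Omega>)"
      using assms(1) sc(1)[of "Suc k"] by (intro measure_mono_ball[of _ _ z "sc k"]) (auto simp: half)
    finally have "1 / 2 * measure M ?B \<le> measure M (ball z (sc k) - \<Omega>)" .
    moreover have "measure M (ball z (sc k)) \<le> D * measure M ?B"
      unfolding half by (rule measure_ball_double)
    then have "1 / (2 * D) * measure M (ball z (sc k)) \<le> 1 / (2 * D) * (D * measure M ?B)"
      using doubling_const_ge_1 by (intro mult_left_mono) auto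
    ultimately show "1 / (2 * D) * measure M (ball z (sc k)) \<le> measure M (ball z (sc k) - \<Omega>)"
      using doubling_const_ge_1 by simp
  qed
qed

end

section \<open>Vitali covering\<close>

text \<open>Zorn's lemma is applied to disjoint subfamilies such that every ball meeting the
  subfamily meets a member of at least half its radius. In a maximal one no ball is missed. This
  requires no compactness or countability of the family.\<close>

lemma vitali_disjoint_subfamily:
  fixes a :: "'i \<Rightarrow> 'a::metric_space" and r :: "'i \<Rightarrow> real"
  assumes "\<And>i. i \<in> I \<Longrightarrow> 0 < r i \<and> r i \<le> R"
  obtains J where "J \<subseteq> I" "disjoint_family_on (\<lambda>j. ball (a j) (r j)) J"
    "\<And>i. i \<in> I \<Longrightarrow> \<exists>j\<in>J. ball (a i) (r i) \<inter> ball (a j) (r j) \<noteq> {} \<and> r i \<le> 2 * r j"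
proof -
  define meets where "meets i j \<longleftrightarrow> ball (a i) (r i) \<inter> ball (a j) (r j) \<noteq> {}" for i j
  define F where "F = {J. J \<subseteq> I \<and> disjoint_family_on (\<lambda>j. ball (a j) (r j)) J \<and>
     (\<forall>i\<in>I. (\<exists>j\<in>J. meets i j) \<longrightarrow> (\<exists>j\<in>J. meets i j \<and> r i \<le> 2 * r j))}"
  have "\<exists>J\<in>F. \<forall>K\<in>F. J \<subseteq> K \<longrightarrow> K = J"
  proof (rule subset_Zorn_nonempty)
    have "{} \<in> F" by (auto simp: F_def disjoint_family_on_def)
    then show "F \<noteq> {}" by auto
  next
    fix \<K> assume \<K>: "\<K> \<noteq> {}" "subset.chain F \<K>"
    have sub: "\<K> \<subseteq> F" using \<K>(2) by (auto simp: subset_chain_def)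
    have "ball (a i) (r i) \<inter> ball (a j) (r j) = {}" if "i \<in> \<Union>\<K>" "j \<in> \<Union>\<K>" "i \<noteq> j" for i j
    proof -
      from that obtain K1 K2 where "K1 \<in> \<K>" "K2 \<in> \<K>" "i \<in> K1" "j \<in> K2" by auto
      moreover from this \<K>(2) have "K1 \<subseteq> K2 \<or> K2 \<subseteq> K1" by (auto simp: subset_chain_def)
      ultimately obtain K where "K \<in> \<K>" "i \<in> K" "j \<in> K" by blast
      with sub that(3) show ?thesis unfolding F_def disjoint_family_on_def by blast
    qed
    then have "disjoint_family_on (\<lambda>j. ball (a j) (r j)) (\<Union>\<K>)"
      unfolding disjoint_family_on_def by blast
    moreover have "\<Union>\<K> \<subseteq> I" using sub unfolding F_def by blast
    moreover have "\<exists>j\<in>\<Union>\<K>. meets i j \<and> r i \<le> 2 * r j"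
      if "i \<in> I" "\<exists>j\<in>\<Union>\<K>. meets i j" for i
    proof -
      from that(2) obtain K where "K \<in> \<K>" "\<exists>j\<in>K. meets i j" by blast
      with sub that(1) have "\<exists>j\<in>K. meets i j \<and> r i \<le> 2 * r j" unfolding F_def by blast
      with \<open>K \<in> \<K>\<close> show ?thesis by blast
    qed
    ultimately show "\<Union>\<K> \<in> F" unfolding F_def by blast
  qed
  then obtain J where J: "J \<in> F" "\<And>K. K \<in> F \<Longrightarrow> J \<subseteq> K \<Longrightarrow> K = J" by blast
  have "\<exists>j\<in>J. meets i j" if i: "i \<in> I" for i
  proof (rule ccontr)
    assume none: "\<not> ?thesis"
    define I' where "I' = {i\<in>I. \<forall>j\<in>J. \<not> meets i j}"
    have "i \<in> I'" using i none by (auto simp: I'_def)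
    have bdd: "bdd_above (r ` I')" using assms by (auto simp: I'_def bdd_above_def)
    have "0 < r i" using assms i by auto
    also have "r i \<le> Sup (r ` I')" using \<open>i \<in> I'\<close> bdd by (intro cSup_upper) auto
    finally have "Sup (r ` I') / 2 < Sup (r ` I')" by simp
    \<comment> \<open>A missed ball with more than half of the supremal missed radius. Adding it
      preserves the comparison of radii: a ball newly met was itself missed, so its radius is at
      most \<open>2 * r k\<close>.\<close>
    then obtain k where k: "k \<in> I'" "Sup (r ` I') / 2 < r k"
      using \<open>i \<in> I'\<close> bdd by (subst (asm) less_cSup_iff) auto
    have big: "r j \<le> 2 * r k" if "j \<in> I'" for j
      using cSup_upper[of "r j" "r ` I'"] that bdd k(2) by fastforce
    have "insert k J \<in> F"
      unfolding F_def
    proof (intro CollectI conjI ballI impI)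
      show "insert k J \<subseteq> I" using k J(1) by (auto simp: F_def I'_def)
      show "disjoint_family_on (\<lambda>j. ball (a j) (r j)) (insert k J)"
        using k J(1) unfolding F_def I'_def meets_def disjoint_family_on_def
        by (auto simp: Int_commute)
      fix j assume "j \<in> I" "\<exists>j'\<in>insert k J. meets j j'"
      then show "\<exists>j'\<in>insert k J. meets j j' \<and> r j \<le> 2 * r j'"
        using big[of j] J(1) by (cases "j \<in> I'") (auto simp: F_def I'_def)
    qed
    then have "k \<in> J" using J(2) by blast
    moreover have "meets k k" using k assms[of k] by (auto simp: meets_def I'_def)
    ultimately show False using k by (auto simp: I'_def)
  qed
  with J(1) show ?thesis
    by (intro that[of J]) (auto simp: F_def meets_def)
qed

text \<open>Second countability permits only countably many disjoint open sets. Positive radii make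
  the balls nonempty, so distinct indices give distinct balls.\<close>

lemma countable_disjoint_balls:
  fixes a :: "'i \<Rightarrow> 'a::{metric_space, second_countable_topology}"
  assumes "disjoint_family_on (\<lambda>j. ball (a j) (r j)) J" "\<And>j. j \<in> J \<Longrightarrow> 0 < r j"
  shows "countable J"
proof -
  have inj: "inj_on (\<lambda>j. ball (a j) (r j)) J"
  proof (rule inj_onI)
    fix i j assume ij: "i \<in> J" "j \<in> J" "ball (a i) (r i) = ball (a j) (r j)"
    then have "a i \<in> ball (a i) (r i) \<inter> ball (a j) (r j)" using assms(2) by auto
    then show "i = j" using assms(1) ij unfolding disjoint_family_on_def by blast
  qed
  have "countable ((\<lambda>j. ball (a j) (r j)) ` J)"
    using disjoint_family_on_disjoint_image[OF assms(1)]
    by (intro countable_disjoint_open_subsets) auto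
  then show ?thesis using inj by (rule countable_image_inj_on)
qed

section \<open>Gauge functions and the boxing inequality\<close>

locale gauge_space = poincare_space M D C L p
  for M :: "'a::polish_space measure" and D C L p :: real +
  fixes \<xi> :: "'a \<Rightarrow> real \<Rightarrow> real" and G K Q :: real
  assumes gauge_pos: "\<And>x r. 0 < r \<Longrightarrow> 0 < \<xi> x r"
    and gauge_doubling_raw: "\<And>x r x' r'. 0 < r \<Longrightarrow> 0 < r' \<Longrightarrow> ball x r \<inter> ball x' r' \<noteq> {} \<Longrightarrow>
      r' \<le> r \<Longrightarrow> r \<le> 2 * r' \<Longrightarrow> inverse G * \<xi> x' r' \<le> \<xi> x r \<and> \<xi> x r \<le> G * \<xi> x' r'"
    and K_ge_1: "1 \<le> K" and p_less_Q: "p < Q"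
    and codim: "\<And>x r R. 0 < r \<Longrightarrow> r \<le> R \<Longrightarrow>
      \<xi> x R / \<xi> x r \<le> K * (codim_gauge M Q x R / codim_gauge M Q x r)"
begin

section \<open>Comparability of the gauges of nearby balls\<close>

lemma G_ge_1: "1 \<le> G"
proof -
  fix x :: 'a
  have "\<xi> x 1 \<le> G * \<xi> x 1" using gauge_doubling_raw[of 1 1 x x] by simp
  then show ?thesis using gauge_pos[of 1 x] by simp
qed

lemma gauge_doubling:
  assumes "0 < r'" "ball x r \<inter> ball x' r' \<noteq> {}" "r' \<le> r" "r \<le> 2 * r'"
  shows "\<xi> x r \<le> G * \<xi> x' r'" "\<xi> x' r' \<le> G * \<xi> x r"
  using gauge_doubling_raw[of r r' x x'] assms G_ge_1 by (auto simp: field_simps)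

lemma gauge_concentric:
  assumes "0 < s" "s \<le> t" "t \<le> 2 ^ n * s"
  shows "\<xi> x t \<le> G ^ n * \<xi> x s \<and> \<xi> x s \<le> G ^ n * \<xi> x t"
  using assms
proof (induction n arbitrary: t)
  case (Suc n)
  \<comment> \<open>The maximum with \<open>s\<close> keeps the intermediate radius in the range of
    the induction hypothesis.\<close>
  define t' where "t' = max s (t / 2)"
  have t': "0 < t'" "s \<le> t'" "t' \<le> t" "t \<le> 2 * t'"
    using Suc.prems by (auto simp: t'_def)
  have "s \<le> 2 ^ n * s" using Suc.prems by simp
  then have "t' \<le> 2 ^ n * s" using Suc.prems by (auto simp: t'_def)
  with Suc.IH[of t'] Suc.prems t'
  have IH: "\<xi> x t' \<le> G ^ n * \<xi> x s" "\<xi> x s \<le> G ^ n * \<xi> x t'" by auto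
  have "x \<in> ball x t \<inter> ball x t'" using t' by auto
  then have ne: "ball x t \<inter> ball x t' \<noteq> {}" by blast
  note db = gauge_doubling[OF t'(1) ne t'(3,4)]
  have "\<xi> x t \<le> G * (G ^ n * \<xi> x s)"
    using db(1) IH(1) G_ge_1 by (meson mult_left_mono order_trans zero_le_one)
  moreover have "\<xi> x s \<le> G ^ n * (G * \<xi> x t)"
    using db(2) IH(2) G_ge_1 by (meson mult_left_mono order_trans zero_le_one zero_le_power)
  ultimately show ?case by (simp add: mult_ac)
qed auto

text \<open>The comparison goes from radius \<open>t\<close> to \<open>s\<close> at
  \<open>y\<close>, up to a radius \<open>R\<close> at which the two balls meet, across to
  \<open>x\<close>, and down to \<open>s\<close> again. The four stages cost \<open>G ^ n\<close>,
  \<open>G ^ n\<close>, \<open>G\<close> and \<open>G ^ n\<close>.\<close>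

lemma gauge_comparable:
  "\<exists>c\<ge>1. \<forall>x y s t. 0 < s \<longrightarrow> 0 < t \<longrightarrow> t \<le> T * s \<longrightarrow> s \<le> T * t \<longrightarrow> dist x y \<le> T * s \<longrightarrow>
    \<xi> y t \<le> c * \<xi> x s"
proof -
  obtain n where n: "T < 2 ^ n" using real_arch_pow[of 2 T] by auto
  show ?thesis
  proof (intro exI conjI allI impI)
    show "1 \<le> G ^ n * (G ^ n * (G * G ^ n))"
      using G_ge_1 by (intro one_le_mult_iff[THEN iffD2] mult_ge1_I one_le_power) auto
    fix x y :: 'a and s t :: real
    assume *: "0 < s" "0 < t" "t \<le> T * s" "s \<le> T * t" "dist x y \<le> T * s"
    define R where "R = 2 ^ n * s"
    have R: "0 < R" "s \<le> R" using * by (auto simp: R_def)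
    have Gn: "0 \<le> G ^ n" "0 \<le> G" using G_ge_1 by auto
    have "t \<le> 2 ^ n * s" "s \<le> 2 ^ n * t"
      using * mult_strict_right_mono[OF n *(1)] mult_strict_right_mono[OF n *(2)] by linarith+
    then have 1: "\<xi> y t \<le> G ^ n * \<xi> y s"
      using gauge_concentric[of s t n y] gauge_concentric[of t s n y] * by linarith
    have 2: "\<xi> y s \<le> G ^ n * \<xi> y R" "\<xi> x R \<le> G ^ n * \<xi> x s"
      using gauge_concentric[of s R n] *(1) R by (auto simp: R_def)
    have "dist x y < R"
      using * mult_strict_right_mono[OF n *(1)] unfolding R_def by linarith
    then have "y \<in> ball y R \<inter> ball x R" using R by auto
    then have "ball y R \<inter> ball x R \<noteq> {}" by blast
    then have 3: "\<xi> y R \<le> G * \<xi> x R"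
      using R by (intro gauge_doubling) auto
    have "\<xi> y R \<le> G * (G ^ n * \<xi> x s)"
      using 3 mult_left_mono[OF 2(2) Gn(2)] by linarith
    then have "\<xi> y s \<le> G ^ n * (G * (G ^ n * \<xi> x s))"
      using 2(1) mult_left_mono[OF _ Gn(1)] by (meson order_trans)
    then have "\<xi> y t \<le> G ^ n * (G ^ n * (G * (G ^ n * \<xi> x s)))"
      using 1 mult_left_mono[OF _ Gn(1)] by (meson order_trans)
    then show "\<xi> y t \<le> G ^ n * (G ^ n * (G * G ^ n)) * \<xi> x s"
      by (simp add: mult.assoc)
  qed
qed

text \<open>A maximal \<open>\<tau>\<close>-separated set supplies the centres. The balls of half
  that radius are disjoint and of measure comparable to that of one ball containing them all, which
  bounds their number. The lemma trades an enlarged ball for smaller balls at bounded cost in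
  gauge.\<close>

lemma finite_cover_ball:
  assumes "1 \<le> T" "1 \<le> T'"
  shows "\<exists>c\<ge>1. \<forall>x t. 0 < t \<longrightarrow> (\<exists>\<D>. finite \<D> \<and> (\<forall>(y, s)\<in>\<D>. s = t / T') \<and>
    ball x (T * t) \<subseteq> (\<Union>(y, s)\<in>\<D>. ball y s) \<and> (\<Sum>(y, s)\<in>\<D>. ennreal (\<xi> y s)) \<le> ennreal (c * \<xi> x t))"
proof -
  \<comment> \<open>The factor is chosen so that multiplying the radius \<open>\<tau> / 2\<close> by
    it gives \<open>(T + 1) * t\<close>.\<close>
  obtain c1 where c1: "1 \<le> c1" "\<And>x y s t. 0 < s \<Longrightarrow> t \<le> 2 * T' * (T + 1) * s \<Longrightarrow>
      dist x y \<le> 2 * T' * (T + 1) * s \<Longrightarrow> measure M (ball y t) \<le> c1 * measure M (ball x s)"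
    using measure_ball_comparable[of "2 * T' * (T + 1)"] by blast
  obtain c2 where c2: "1 \<le> c2" "\<And>x y s t. 0 < s \<Longrightarrow> 0 < t \<Longrightarrow> t \<le> T * T' * s \<Longrightarrow>
      s \<le> T * T' * t \<Longrightarrow> dist x y \<le> T * T' * s \<Longrightarrow> \<xi> y t \<le> c2 * \<xi> x s"
    using gauge_comparable[of "T * T'"] by blast
  have TT': "1 \<le> T * T'" using assms mult_mono[of 1 T 1 T'] by simp
  have "\<exists>\<D>. finite \<D> \<and> (\<forall>(y, s)\<in>\<D>. s = t / T') \<and>
    ball x (T * t) \<subseteq> (\<Union>(y, s)\<in>\<D>. ball y s) \<and>
    (\<Sum>(y, s)\<in>\<D>. ennreal (\<xi> y s)) \<le> ennreal (c1 * c2 * \<xi> x t)" if t: "0 < t" for x t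
  proof -
    define \<tau> where "\<tau> = t / T'"
    have \<tau>: "0 < \<tau>" "\<tau> \<le> t" "t = T' * \<tau>" using t assms by (auto simp: \<tau>_def field_simps)
    define sep where "sep P \<longleftrightarrow> finite P \<and> P \<subseteq> ball x (T * t) \<and> (\<forall>y\<in>P. \<forall>z\<in>P. y \<noteq> z \<longrightarrow> \<tau> \<le> dist y z)"
      for P
    have card: "real (card P) \<le> c1" if P: "sep P" for P
    proof -
      let ?m = "measure M (ball x ((T + 1) * t))"
      have m: "0 < ?m" using assms t by (intro measure_ball_pos) auto
      have disj: "disjoint_family_on (\<lambda>y. ball y (\<tau> / 2)) P"
        unfolding disjoint_family_on_def
      proof (intro ballI impI)
        fix y z assume yz: "y \<in> P" "z \<in> P" "y \<noteq> z"
        show "ball y (\<tau> / 2) \<inter> ball z (\<tau> / 2) = {}"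
        proof (rule ccontr)
          assume "ball y (\<tau> / 2) \<inter> ball z (\<tau> / 2) \<noteq> {}"
          then obtain w where "dist y w < \<tau> / 2" "dist z w < \<tau> / 2" by auto
          then have "dist y z < \<tau>" using dist_triangle2[of y z w] by simp
          moreover have "\<tau> \<le> dist y z" using P yz unfolding sep_def by blast
          ultimately show False by simp
        qed
      qed
      have sub: "ball y (\<tau> / 2) \<subseteq> ball x ((T + 1) * t)" if "y \<in> P" for y
      proof
        fix w assume "w \<in> ball y (\<tau> / 2)"
        then have "dist y w < \<tau> / 2" by simp
        moreover have "dist x y < T * t" using P that by (auto simp: sep_def)
        ultimately have "dist x w < T * t + t"
          using dist_triangle[of x w y] \<tau>(1,2) by linarith
        then show "w \<in> ball x ((T + 1) * t)" by (simp add: algebra_simps)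
      qed
      have "?m \<le> c1 * measure M (ball y (\<tau> / 2))" if "y \<in> P" for y
      proof (rule c1(2))
        have "dist x y < T * t" using P that by (auto simp: sep_def)
        also have "\<dots> \<le> (T + 1) * t" using t by simp
        also have le: "\<dots> \<le> 2 * T' * (T + 1) * (\<tau> / 2)" by (simp add: \<tau>(3))
        finally show "dist y x \<le> 2 * T' * (T + 1) * (\<tau> / 2)" by (simp add: dist_commute)
        show "(T + 1) * t \<le> 2 * T' * (T + 1) * (\<tau> / 2)" by (rule le)
      qed (use \<tau> in simp)
      then have "real (card P) * ?m \<le> (\<Sum>y\<in>P. c1 * measure M (ball y (\<tau> / 2)))"
        using sum_mono[of P "\<lambda>_. ?m" "\<lambda>y. c1 * measure M (ball y (\<tau> / 2))"] by simp
      also have "\<dots> = c1 * measure M (\<Union>y\<in>P. ball y (\<tau> / 2))"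
        using P disj emeasure_ball_finite
        by (subst measure_finite_Union) (auto simp: sep_def sum_distrib_left sets_M less_top[symmetric])
      also have "\<dots> \<le> c1 * ?m"
        using sub c1(1) by (intro mult_left_mono measure_mono_ball[of _ _ x "(T + 1) * t"]) (auto intro!: borel_open)
      finally show ?thesis using m by simp
    qed
    have "sep {}" by (simp add: sep_def)
    moreover have "\<forall>P. sep P \<longrightarrow> card P < Suc (nat \<lfloor>c1\<rfloor>)"
      using card by (auto simp: le_nat_floor less_Suc_eq_le)
    ultimately have "\<exists>P. sep P \<and> (\<forall>P'. sep P' \<longrightarrow> card P' \<le> card P)"
      by (rule ex_has_greatest_nat)
    \<comment> \<open>Cardinalities of separated sets are bounded by \<open>c1\<close>, so a largest
      one exists. A point at distance at least \<open>\<tau>\<close> from it could be added.\<close>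
    then obtain P where P: "sep P" "\<And>P'. sep P' \<Longrightarrow> card P' \<le> card P" by auto
    have cov: "\<exists>y\<in>P. w \<in> ball y \<tau>" if w: "w \<in> ball x (T * t)" for w
    proof (rule ccontr)
      assume no: "\<not> ?thesis"
      then have "w \<notin> P" using \<tau> by auto
      moreover have "sep (insert w P)"
        using no P(1) w unfolding sep_def by (auto simp: dist_commute not_less)
      ultimately show False using P(2)[of "insert w P"] P(1) by (auto simp: sep_def)
    qed
    let ?D = "(\<lambda>y. (y, \<tau>)) ` P"
    have inj: "inj_on (\<lambda>y. (y, \<tau>)) P" by (auto simp: inj_on_def)
    have "(\<Sum>(y, s)\<in>?D. ennreal (\<xi> y s)) = (\<Sum>y\<in>P. ennreal (\<xi> y \<tau>))"
      by (simp add: sum.reindex[OF inj])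
    also have "\<dots> \<le> (\<Sum>y\<in>P. ennreal (c2 * \<xi> x t))"
    proof (intro sum_mono ennreal_leI c2(2))
      fix y assume "y \<in> P"
      then have "dist x y < T * t" using P(1) by (auto simp: sep_def)
      also have "\<dots> \<le> T * T' * t" using assms t by simp
      finally show "dist x y \<le> T * T' * t" by simp
      show "\<tau> \<le> T * T' * t" using TT' \<tau> mult_mono[OF TT' \<tau>(2)] by simp
      have "T' * \<tau> \<le> T * (T' * \<tau>)" using assms \<tau> by simp
      then show "t \<le> T * T' * \<tau>" using \<tau>(3) by (simp add: mult.assoc)
    qed (use t \<tau> in auto)
    also have "\<dots> = ennreal (real (card P) * (c2 * \<xi> x t))"
      using gauge_pos[OF t, of x] c2(1) by (simp add: ennreal_mult ennreal_of_nat_eq_real_of_nat)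
    also have "\<dots> \<le> ennreal (c1 * c2 * \<xi> x t)"
      using card[OF P(1)] gauge_pos[OF t, of x] c2(1)
      by (intro ennreal_leI) (simp add: mult.assoc mult_right_mono)
    finally show ?thesis
      using P(1) cov by (intro exI[of _ ?D]) (auto simp: sep_def \<tau>_def)
  qed
  moreover have "1 \<le> c1 * c2" using c1(1) c2(1) mult_mono[of 1 c1 1 c2] by simp
  ultimately show ?thesis by blast
qed

section \<open>The codimension condition and the boxing inequality at a single scale\<close>

lemma gauge_codim:
  assumes "0 < r" "r \<le> s"
  shows "r powr - p * measure M (ball y r) * \<xi> y s \<le> K * (s powr - p * measure M (ball y s)) * \<xi> y r"
proof -
  have s: "0 < s" using assms by simp
  have pos: "0 < measure M (ball y r)" "0 < measure M (ball y s)" "0 < \<xi> y r" "0 < \<xi> y s"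
    using measure_ball_pos gauge_pos assms s by auto
  have "\<xi> y s / \<xi> y r \<le> K * ((measure M (ball y s) / s powr Q) / (measure M (ball y r) / r powr Q))"
    using codim[OF assms, of y] by (simp add: codim_gauge_def)
  then have "measure M (ball y r) * \<xi> y s * s powr Q \<le> K * measure M (ball y s) * \<xi> y r * r powr Q"
    using pos assms s by (simp add: field_simps)
  then have "r powr - p * s powr - Q * (measure M (ball y r) * \<xi> y s * s powr Q)
    \<le> r powr - p * s powr - Q * (K * measure M (ball y s) * \<xi> y r * r powr Q)"
    by (rule mult_left_mono) simp
  also have "r powr - p * s powr - Q * (measure M (ball y r) * \<xi> y s * s powr Q)
      = (s powr - Q * s powr Q) * (r powr - p * measure M (ball y r) * \<xi> y s)"
    by (simp only: mult_ac)
  also have "s powr - Q * s powr Q = 1"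
    using s by (simp add: powr_add[symmetric])
  also have "r powr - p * s powr - Q * (K * measure M (ball y s) * \<xi> y r * r powr Q)
      = s powr - Q * (r powr - p * r powr Q) * (K * measure M (ball y s) * \<xi> y r)"
    by (simp only: mult_ac)
  also have "r powr - p * r powr Q = r powr (Q - p)"
    by (simp add: powr_add[symmetric])
  finally have "r powr - p * measure M (ball y r) * \<xi> y s
    \<le> s powr - Q * r powr (Q - p) * (K * measure M (ball y s) * \<xi> y r)"
    by simp
  \<comment> \<open>The exponent \<open>Q - p\<close> is positive, so \<open>r \<le> s\<close> lets
    the surplus power of \<open>r\<close> be replaced by that of \<open>s\<close>, turning exponent
    \<open>Q\<close> into \<open>p\<close>.\<close>
  also have "\<dots> \<le> s powr - Q * s powr (Q - p) * (K * measure M (ball y s) * \<xi> y r)"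
    using assms p_less_Q pos K_ge_1 by (intro mult_right_mono mult_left_mono powr_mono2) auto
  also have "s powr - Q * s powr (Q - p) = s powr - p"
    by (simp add: powr_add[symmetric])
  finally show ?thesis by (simp add: mult_ac)
qed

text \<open>If the doubled balls leave at least half of the required complement uncovered,
  \<open>poincare_cover\<close> applies. Otherwise they carry much measure themselves, and
  subadditivity with \<open>r \<le> s\<close> gives the same bound on \<open>W\<close>. Codimension
  then converts each term into a gauge.\<close>

lemma relative_boxing:
  assumes "0 < c0"
  shows "\<exists>c>0. \<forall>\<Omega> \<C> z s. open \<Omega> \<longrightarrow> countable \<C> \<longrightarrow> 0 < s \<longrightarrow>
    (\<forall>(y, r)\<in>\<C>. 0 < r \<and> r \<le> s \<and> ball y (2 * r) \<inter> cball z (L * s) \<noteq> {}) \<longrightarrow>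
    frontier \<Omega> \<inter> cball z (L * s) \<subseteq> (\<Union>(y, r)\<in>\<C>. ball y r) \<longrightarrow>
    c0 * measure M (ball z s) \<le> measure M (ball z s \<inter> \<Omega>) \<longrightarrow>
    c0 * measure M (ball z s) \<le> measure M (ball z s - \<Omega>) \<longrightarrow>
    ennreal (c * \<xi> z s) \<le> (\<Sum>\<^sub>\<infinity>(y, r)\<in>\<C>. ennreal (\<xi> y r))"
proof -
  \<comment> \<open>A centre \<open>y\<close> lies within
    \<open>L * s + 2 * r \<le> (L + 2) * s\<close> of \<open>z\<close>.\<close>
  define T where "T = L + 2"
  have T: "1 \<le> T" using L_ge_1 by (simp add: T_def)
  obtain c1 where c1: "1 \<le> c1" "\<And>x y s t. 0 < s \<Longrightarrow> t \<le> T * s \<Longrightarrow>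
      dist x y \<le> T * s \<Longrightarrow> measure M (ball y t) \<le> c1 * measure M (ball x s)"
    using measure_ball_comparable[of T] by blast
  obtain c2 where c2: "1 \<le> c2" "\<And>x y s t. 0 < s \<Longrightarrow> 0 < t \<Longrightarrow> t \<le> T * s \<Longrightarrow>
      s \<le> T * t \<Longrightarrow> dist x y \<le> T * s \<Longrightarrow> \<xi> y t \<le> c2 * \<xi> x s"
    using gauge_comparable[of T] by blast
  \<comment> \<open>The minimum serves both cases for the complement. In \<open>k2\<close> the
    factor \<open>D\<close> pays for replacing radius \<open>2 * r\<close> by \<open>r\<close>,
    \<open>K\<close> for codimension, and \<open>c1\<close>, \<open>c2\<close> for moving measure
    and gauge at scale \<open>s\<close> between \<open>y\<close> and \<open>z\<close>.\<close>
  define k1 where "k1 = min (c0 / 2) ((c0 / (4 * C)) powr p)"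
  define k2 where "k2 = D * K * c1 * c2"
  have k1: "0 < k1" using assms C_ge_1 by (simp add: k1_def)
  have k2: "0 < k2" using doubling_const_ge_1 K_ge_1 c1(1) c2(1) by (simp add: k2_def)
  show ?thesis
  proof (intro exI[of _ "k1 / k2"] conjI allI impI)
    show "0 < k1 / k2" using k1 k2 by simp
    fix \<Omega> :: "'a set" and \<C> z and s :: real
    assume op: "open \<Omega>" and ct: "countable \<C>" and s: "0 < s"
      and cv: "\<forall>(y, r)\<in>\<C>. 0 < r \<and> r \<le> s \<and> ball y (2 * r) \<inter> cball z (L * s) \<noteq> {}"
      and fr: "frontier \<Omega> \<inter> cball z (L * s) \<subseteq> (\<Union>(y, r)\<in>\<C>. ball y r)"
      and in1: "c0 * measure M (ball z s) \<le> measure M (ball z s \<inter> \<Omega>)"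
      and in0: "c0 * measure M (ball z s) \<le> measure M (ball z s - \<Omega>)"
    define m where "m = measure M (ball z s)"
    have m: "0 < m" unfolding m_def by (rule measure_ball_pos[OF s])
    define U where "U = (\<Union>(y, r)\<in>\<C>. ball y (2 * r))"
    have opU: "open U" unfolding U_def by auto
    define W where "W = (\<Sum>\<^sub>\<infinity>(y, r)\<in>\<C>. ennreal (r powr - p * measure M (ball y (2 * r))))"
    define S where "S = (\<Sum>\<^sub>\<infinity>(y, r)\<in>\<C>. ennreal (\<xi> y r))"
    have ri: "0 < r" "r \<le> s" "dist z y \<le> T * s" if "(y, r) \<in> \<C>" for y r
    proof -
      from cv that have *: "0 < r" "r \<le> s" "ball y (2 * r) \<inter> cball z (L * s) \<noteq> {}" by auto
      then show "0 < r" "r \<le> s" by auto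
      from *(3) obtain w where "dist y w < 2 * r" "dist z w \<le> L * s" by auto
      then show "dist z y \<le> T * s"
        using dist_triangle2[of z y w] *(2) by (simp add: T_def algebra_simps)
    qed
    have "ennreal (k1 * (s powr - p * m)) \<le> W"
    proof (cases "c0 / 2 * m \<le> measure M (ball z s - \<Omega> - U)")
      case True
      have "c0 / 2 * m \<le> c0 * m" using assms m by simp
      then have "c0 / 2 * m \<le> measure M (ball z s \<inter> \<Omega>)" using in1 by (simp add: m_def)
      then have "ennreal ((c0 / 2 / (2 * C * s)) powr p * m) \<le> W"
        unfolding W_def m_def
        using True op ct s assms ri fr unfolding m_def U_def
        by (intro poincare_cover[of \<Omega>]) auto
      moreover have "(c0 / 2 / (2 * C * s)) powr p = (c0 / (4 * C)) powr p * s powr - p"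
      proof -
        have "c0 / 2 / (2 * C * s) = (c0 / (4 * C)) / s" by simp
        then show ?thesis
          using assms C_ge_1 s by (simp add: powr_divide powr_mult powr_minus_divide)
      qed
      moreover have "k1 * (s powr - p * m) \<le> (c0 / (4 * C)) powr p * (s powr - p * m)"
        using m by (intro mult_right_mono) (auto simp: k1_def)
      ultimately show ?thesis
        by (metis ennreal_leI mult.assoc order_trans)
    next
      case False
      have "c0 * m \<le> measure M ((ball z s - \<Omega> - U) \<union> (ball z s \<inter> U))"
        using in0 op opU unfolding m_def
        by (intro order_trans[OF in0] measure_mono_ball[of _ _ z s]) auto
      also have "\<dots> \<le> measure M (ball z s - \<Omega> - U) + measure M (ball z s \<inter> U)"
        using op opU by (intro measure_Un_le) (auto simp: sets_M)
      finally have "c0 / 2 * m \<le> measure M (ball z s \<inter> U)" using False by simp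
      then have "ennreal (c0 / 2 * m) \<le> emeasure M (ball z s \<inter> U)"
        by (subst emeasure_finite_sub_ball[of _ z s]) (auto intro: ennreal_leI)
      also have "\<dots> \<le> emeasure M U"
        using opU by (intro emeasure_mono) auto
      also have "\<dots> \<le> (\<Sum>\<^sub>\<infinity>(y, r)\<in>\<C>. emeasure M (ball y (2 * r)))"
        using emeasure_UN_le_infsum[OF ct, of "\<lambda>(y, r). ball y (2 * r)" M]
        unfolding U_def by (simp add: case_prod_beta')
      finally have "ennreal (s powr - p) * ennreal (c0 / 2 * m)
        \<le> ennreal (s powr - p) * (\<Sum>\<^sub>\<infinity>(y, r)\<in>\<C>. emeasure M (ball y (2 * r)))"
        by (intro mult_left_mono) auto
      also have "\<dots> = (\<Sum>\<^sub>\<infinity>i\<in>\<C>. ennreal (s powr - p) * emeasure M (ball (fst i) (2 * snd i)))"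
        by (simp add: infsum_cmult_ennreal case_prod_beta')
      also have "\<dots> \<le> W"
        unfolding W_def case_prod_beta
      proof (intro infsum_mono)
        fix i assume "i \<in> \<C>"
        then have "0 < snd i" "snd i \<le> s" using ri[of "fst i" "snd i"] by auto
        then have "s powr - p \<le> snd i powr - p"
          using p_ge_1 by (intro powr_mono2') auto
        then show "ennreal (s powr - p) * emeasure M (ball (fst i) (2 * snd i))
          \<le> ennreal (snd i powr - p * measure M (ball (fst i) (2 * snd i)))"
          by (simp add: emeasure_ball mult_right_mono ennreal_leI flip: ennreal_mult)
      qed auto
      finally have "ennreal (c0 / 2 * (s powr - p * m)) \<le> W"
        using assms m by (simp add: mult_ac flip: ennreal_mult)
      moreover have "k1 * (s powr - p * m) \<le> c0 / 2 * (s powr - p * m)"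
        using m by (intro mult_right_mono) (auto simp: k1_def)
      ultimately show ?thesis by (meson ennreal_leI order_trans)
    qed
    also have "W \<le> (\<Sum>\<^sub>\<infinity>i\<in>\<C>. ennreal (k2 * (s powr - p * m) / \<xi> z s) * ennreal (\<xi> (fst i) (snd i)))"
      unfolding W_def case_prod_beta
    proof (intro infsum_mono)
      fix i assume i: "i \<in> \<C>"
      obtain y r where [simp]: "i = (y, r)" by force
      have r: "0 < r" "r \<le> s" "dist z y \<le> T * s" using ri[of y r] i by auto
      have \<xi>: "0 < \<xi> z s" "0 < \<xi> y s" "0 < \<xi> y r" using gauge_pos r s by auto
      have Ts: "s \<le> T * s" using T s by simp
      have "\<xi> z s \<le> c2 * \<xi> y s"
        using c2(2)[of s s y z] s Ts r by (simp add: dist_commute)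
      moreover have "measure M (ball y (2 * r)) \<le> D * measure M (ball y r)" by (rule measure_ball_double)
      ultimately have "r powr - p * measure M (ball y (2 * r)) * \<xi> z s
        \<le> r powr - p * (D * measure M (ball y r)) * (c2 * \<xi> y s)"
        using \<xi> doubling_const_ge_1 by (intro mult_mono) auto
      also have "\<dots> = (D * c2) * (r powr - p * measure M (ball y r) * \<xi> y s)" by simp
      also have "\<dots> \<le> (D * c2) * (K * (s powr - p * measure M (ball y s)) * \<xi> y r)"
        using gauge_codim[OF r(1,2), of y] c2(1) doubling_const_ge_1 by (intro mult_left_mono) auto
      also have "\<dots> \<le> (D * c2) * (K * (s powr - p * (c1 * m)) * \<xi> y r)"
        using c1(2)[of s s z y] s Ts r c2(1) doubling_const_ge_1 K_ge_1 \<xi>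
        by (intro mult_left_mono mult_right_mono) (auto simp: m_def)
      also have "\<dots> = k2 * (s powr - p * m) * \<xi> y r" by (simp add: k2_def)
      finally have "r powr - p * measure M (ball y (2 * r)) \<le> k2 * (s powr - p * m) / \<xi> z s * \<xi> y r"
        using \<xi> by (simp add: field_simps)
      then show "ennreal (snd i powr - p * measure M (ball (fst i) (2 * snd i)))
        \<le> ennreal (k2 * (s powr - p * m) / \<xi> z s) * ennreal (\<xi> (fst i) (snd i))"
        using k2 m \<xi> by (simp add: ennreal_leI flip: ennreal_mult)
    qed auto
    also have "\<dots> = ennreal (k2 * (s powr - p * m) / \<xi> z s) * S"
      unfolding S_def case_prod_beta by (rule infsum_cmult_ennreal)
    finally have main: "ennreal (k1 * (s powr - p * m)) \<le> ennreal (k2 * (s powr - p * m) / \<xi> z s) * S" .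
    show "ennreal (k1 / k2 * \<xi> z s) \<le> (\<Sum>\<^sub>\<infinity>(y, r)\<in>\<C>. ennreal (\<xi> y r))"
      unfolding S_def[symmetric]
    proof (cases S)
      case (real w)
      have sm: "0 < s powr - p * m" using s m by simp
      have \<xi>: "0 < \<xi> z s" using gauge_pos s by auto
      have "k1 * (s powr - p * m) \<le> k2 * (s powr - p * m) / \<xi> z s * w"
        using main real k1 k2 sm \<xi> by (simp flip: ennreal_mult)
      also have "\<dots> = k2 / \<xi> z s * w * (s powr - p * m)" using \<xi> by (simp add: field_simps)
      finally have "k1 \<le> k2 / \<xi> z s * w" using sm by (rule mult_right_le_imp_le)
      then show "ennreal (k1 / k2 * \<xi> z s) \<le> S"
        using real k2 \<xi> by (simp add: ennreal_leI field_simps)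
    qed simp
  qed
qed

section \<open>From a single scale to the Hausdorff content of the complement\<close>

lemma hausdorff_content_le_cover:
  assumes "1 \<le> T" "1 \<le> A"
  shows "\<exists>c\<ge>1. \<forall>\<C> E r. countable \<C> \<longrightarrow> 0 < r \<longrightarrow> (\<forall>(y, s)\<in>\<C>. 0 < s \<and> s \<le> A * r) \<longrightarrow>
    E \<subseteq> (\<Union>(y, s)\<in>\<C>. ball y (T * s)) \<longrightarrow>
    hausdorff_content \<xi> (ennreal r) E \<le> ennreal c * (\<Sum>\<^sub>\<infinity>(y, s)\<in>\<C>. ennreal (\<xi> y s))"
proof -
  obtain c where c: "1 \<le> c" "\<And>x t. 0 < t \<Longrightarrow> \<exists>\<D>. finite \<D> \<and> (\<forall>(y, s)\<in>\<D>. s = t / A) \<and>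
    ball x (T * t) \<subseteq> (\<Union>(y, s)\<in>\<D>. ball y s) \<and> (\<Sum>(y, s)\<in>\<D>. ennreal (\<xi> y s)) \<le> ennreal (c * \<xi> x t)"
    using finite_cover_ball[OF assms] by blast
  have "hausdorff_content \<xi> (ennreal r) E \<le> ennreal c * (\<Sum>\<^sub>\<infinity>(y, s)\<in>\<C>. ennreal (\<xi> y s))"
    if ct: "countable \<C>" and r: "0 < r" and rad: "\<forall>(y, s)\<in>\<C>. 0 < s \<and> s \<le> A * r"
      and cov: "E \<subseteq> (\<Union>(y, s)\<in>\<C>. ball y (T * s))" for \<C> E r
  proof -
    \<comment> \<open>Each enlarged ball is exchanged for finitely many balls of radius
      \<open>snd i / A\<close>. This is at most \<open>r\<close>, so they are admissible for the
      content at scale \<open>r\<close>.\<close>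
    have "\<forall>i\<in>\<C>. \<exists>\<D>. finite \<D> \<and> (\<forall>(y, s)\<in>\<D>. s = snd i / A) \<and>
      ball (fst i) (T * snd i) \<subseteq> (\<Union>(y, s)\<in>\<D>. ball y s) \<and>
      (\<Sum>(y, s)\<in>\<D>. ennreal (\<xi> y s)) \<le> ennreal (c * \<xi> (fst i) (snd i))"
      using rad by (intro ballI c(2)) auto
    from bchoice[OF this] obtain \<D> where "\<forall>i\<in>\<C>. finite (\<D> i) \<and> (\<forall>(y, s)\<in>\<D> i. s = snd i / A) \<and>
      ball (fst i) (T * snd i) \<subseteq> (\<Union>(y, s)\<in>\<D> i. ball y s) \<and>
      (\<Sum>(y, s)\<in>\<D> i. ennreal (\<xi> y s)) \<le> ennreal (c * \<xi> (fst i) (snd i))" ..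
    then have \<D>: "\<And>i. i \<in> \<C> \<Longrightarrow> finite (\<D> i)"
      "\<And>i y s. i \<in> \<C> \<Longrightarrow> (y, s) \<in> \<D> i \<Longrightarrow> s = snd i / A"
      "\<And>i. i \<in> \<C> \<Longrightarrow> ball (fst i) (T * snd i) \<subseteq> (\<Union>(y, s)\<in>\<D> i. ball y s)"
      "\<And>i. i \<in> \<C> \<Longrightarrow> (\<Sum>(y, s)\<in>\<D> i. ennreal (\<xi> y s)) \<le> ennreal (c * \<xi> (fst i) (snd i))"
      by fast+
    have "hausdorff_content \<xi> (ennreal r) E \<le> (\<Sum>\<^sub>\<infinity>(y, s)\<in>(\<Union>i\<in>\<C>. \<D> i). ennreal (\<xi> y s))"
    proof (rule hausdorff_content_le)
      show "countable (\<Union>i\<in>\<C>. \<D> i)" using ct \<D>(1) by (intro countable_UN) (auto intro: countable_finite)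
      show "0 < s \<and> ennreal s \<le> ennreal r" if ys: "(y, s) \<in> (\<Union>i\<in>\<C>. \<D> i)" for y s
      proof -
        from ys obtain i where "i \<in> \<C>" "(y, s) \<in> \<D> i" by blast
        then have i: "s = snd i / A" "0 < snd i" "snd i \<le> A * r" using \<D>(2) rad by auto
        have "0 < s" "s \<le> r"
          unfolding i(1) using i(2,3) assms by (auto simp: divide_le_eq mult.commute)
        then show ?thesis by (simp add: ennreal_leI)
      qed
      show "E \<subseteq> (\<Union>(y, s)\<in>(\<Union>i\<in>\<C>. \<D> i). ball y s)"
      proof
        fix w assume "w \<in> E"
        then obtain i where "i \<in> \<C>" "w \<in> ball (fst i) (T * snd i)" using cov by fastforce
        then show "w \<in> (\<Union>(y, s)\<in>(\<Union>i\<in>\<C>. \<D> i). ball y s)" using \<D>(3) by blast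
      qed
    qed
    also have "\<dots> \<le> (\<Sum>\<^sub>\<infinity>i\<in>\<C>. (\<Sum>\<^sub>\<infinity>(y, s)\<in>\<D> i. ennreal (\<xi> y s)))"
      by (rule infsum_UN_le_ennreal)
    also have "\<dots> \<le> (\<Sum>\<^sub>\<infinity>i\<in>\<C>. ennreal c * (case i of (y, s) \<Rightarrow> ennreal (\<xi> y s)))"
    proof (intro infsum_mono)
      fix i assume i: "i \<in> \<C>"
      have "0 < snd i" using i rad by auto
      then have "ennreal (c * \<xi> (fst i) (snd i)) = ennreal c * (case i of (y, s) \<Rightarrow> ennreal (\<xi> y s))"
        using c(1) gauge_pos[of "snd i" "fst i"] by (simp add: ennreal_mult case_prod_beta)
      then show "(\<Sum>\<^sub>\<infinity>(y, s)\<in>\<D> i. ennreal (\<xi> y s)) \<le> ennreal c * (case i of (y, s) \<Rightarrow> ennreal (\<xi> y s))"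
        using \<D>(1,4)[OF i] by simp
    qed auto
    also have "\<dots> = ennreal c * (\<Sum>\<^sub>\<infinity>(y, s)\<in>\<C>. ennreal (\<xi> y s))"
      by (rule infsum_cmult_ennreal)
    finally show ?thesis .
  qed
  with c(1) show ?thesis by blast
qed

lemma hausdorff_content_complement_le:
  assumes "1 \<le> C_hat"
  shows "\<exists>C2 c. 1 \<le> C2 \<and> 1 \<le> c \<and> (\<forall>\<Omega> x0 r \<C>. open \<Omega> \<longrightarrow> x0 \<in> \<Omega> \<longrightarrow> 0 < r \<longrightarrow>
    r = infdist x0 (frontier \<Omega>) \<longrightarrow> countable \<C> \<longrightarrow> (\<forall>(y, s)\<in>\<C>. 0 < s \<and> s \<le> r) \<longrightarrow>
    frontier \<Omega> \<inter> ball x0 (C2 * r) \<subseteq> (\<Union>(y, s)\<in>\<C>. ball y s) \<longrightarrow>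
    hausdorff_content \<xi> (ennreal r) (ball x0 (C_hat * r) - \<Omega>)
      \<le> ennreal c * (\<Sum>\<^sub>\<infinity>(y, s)\<in>\<C>. ennreal (\<xi> y s)))"
proof -
  \<comment> \<open>Scales up to \<open>A * r\<close> are enough: for \<open>z\<close> within
    \<open>C_hat * r\<close> of \<open>x0\<close>, \<open>ball z (A * r)\<close> contains the small
    ball around \<open>x0\<close> that lies in \<open>\<Omega>\<close>.\<close>
  define A where "A = C_hat + 1"
  \<comment> \<open>Large enough that the frontier within \<open>L * (A * r)\<close> of such a point
    \<open>z\<close> is still covered.\<close>
  define C2 where "C2 = C_hat + 2 * L * A"
  \<comment> \<open>The centres of small balls near \<open>z\<close> lie within
    \<open>N * \<sigma> z\<close> of \<open>z\<close>. The factor 3 in \<open>T\<close> comes from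
    the Vitali selection.\<close>
  define N where "N = L + 4"
  define T where "T = 3 * N"
  have A: "1 \<le> A" "C_hat \<le> A" using assms by (auto simp: A_def)
  have LA: "1 \<le> L * A" "A \<le> L * A" using L_ge_1 A mult_mono[of 1 L 1 A] by auto
  have C2: "1 \<le> C2" "C_hat \<le> C2" using assms LA unfolding C2_def by linarith+
  have N: "1 \<le> N" "1 \<le> T" using L_ge_1 by (auto simp: N_def T_def)
  obtain c1 where c1: "1 \<le> c1" "\<And>x y s t. 0 < s \<Longrightarrow> t \<le> 2 * L * A * s \<Longrightarrow>
      dist x y \<le> 2 * L * A * s \<Longrightarrow> measure M (ball y t) \<le> c1 * measure M (ball x s)"
    using measure_ball_comparable[of "2 * L * A"] by blast
  \<comment> \<open>The first term is a density of \<open>\<Omega>\<close> at the top scale, the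
    second the density of the complement supplied by \<open>intermediate_scale\<close>.\<close>
  define c0 where "c0 = min (1 / (2 * c1)) (1 / (2 * D))"
  have c0: "0 < c0" "c0 \<le> 1 / 2" "c0 * c1 \<le> 1" "c0 \<le> 1 / (2 * D)"
  proof -
    show "0 < c0" "c0 \<le> 1 / (2 * D)" using c1(1) doubling_const_ge_1 by (auto simp: c0_def)
    have "c0 \<le> 1 / (2 * c1)" by (simp add: c0_def)
    moreover have "1 / (2 * c1) \<le> 1 / 2" using c1(1) by (simp add: field_simps)
    ultimately show "c0 \<le> 1 / 2" by simp
    have "c0 * c1 \<le> 1 / (2 * c1) * c1" using c1(1) by (intro mult_right_mono) (auto simp: c0_def)
    also have "\<dots> \<le> 1" using c1(1) by simp
    finally show "c0 * c1 \<le> 1" .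
  qed
  obtain c3 where c3: "0 < c3" "\<And>\<Omega> \<C> z s. open \<Omega> \<Longrightarrow> countable \<C> \<Longrightarrow> 0 < s \<Longrightarrow>
    (\<forall>(y, r)\<in>\<C>. 0 < r \<and> r \<le> s \<and> ball y (2 * r) \<inter> cball z (L * s) \<noteq> {}) \<Longrightarrow>
    frontier \<Omega> \<inter> cball z (L * s) \<subseteq> (\<Union>(y, r)\<in>\<C>. ball y r) \<Longrightarrow>
    c0 * measure M (ball z s) \<le> measure M (ball z s \<inter> \<Omega>) \<Longrightarrow>
    c0 * measure M (ball z s) \<le> measure M (ball z s - \<Omega>) \<Longrightarrow>
    ennreal (c3 * \<xi> z s) \<le> (\<Sum>\<^sub>\<infinity>(y, r)\<in>\<C>. ennreal (\<xi> y r))"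
    using relative_boxing[OF c0(1)] by blast
  obtain c4 where c4: "1 \<le> c4" "\<And>\<C> E r. countable \<C> \<Longrightarrow> 0 < r \<Longrightarrow>
    (\<forall>(y, s)\<in>\<C>. 0 < s \<and> s \<le> A * r) \<Longrightarrow> E \<subseteq> (\<Union>(y, s)\<in>\<C>. ball y (T * s)) \<Longrightarrow>
    hausdorff_content \<xi> (ennreal r) E \<le> ennreal c4 * (\<Sum>\<^sub>\<infinity>(y, s)\<in>\<C>. ennreal (\<xi> y s))"
    using hausdorff_content_le_cover[OF N(2) A(1)] by blast
  have "hausdorff_content \<xi> (ennreal r) (ball x0 (C_hat * r) - \<Omega>)
      \<le> ennreal (c4 * (1 + 1 / c3)) * (\<Sum>\<^sub>\<infinity>(y, s)\<in>\<C>. ennreal (\<xi> y s))"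
    if op: "open \<Omega>" and x0: "x0 \<in> \<Omega>" and r: "0 < r" "r = infdist x0 (frontier \<Omega>)"
      and ct: "countable \<C>" and rad: "\<forall>(y, s)\<in>\<C>. 0 < s \<and> s \<le> r"
      and cov: "frontier \<Omega> \<inter> ball x0 (C2 * r) \<subseteq> (\<Union>(y, s)\<in>\<C>. ball y s)" for \<Omega> x0 r \<C>
  proof -
    define S where "S = (\<Sum>\<^sub>\<infinity>(y, s)\<in>\<C>. ennreal (\<xi> y s))"
    \<comment> \<open>Points of the frontier are left out: the given cover already contains them,
      and \<open>intermediate_scale\<close> requires a point off the closure.\<close>
    define E where "E = ball x0 (C_hat * r) - closure \<Omega>"
    have rho: "0 < r / (2 * L)" "r / (2 * L) \<le> r / 2"
      using r L_ge_1 by (auto simp: field_simps)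
    have inside: "ball x0 (r / (2 * L)) \<subseteq> \<Omega>"
    proof (rule ball_subset_if_frontier_free[OF op x0 rho(1)])
      have "dist x0 y > r / 2" if "y \<in> frontier \<Omega>" for y
        using infdist_le[OF that, of x0] r by simp
      then show "frontier \<Omega> \<inter> cball x0 (L * (r / (2 * L))) = {}"
        using L_ge_1 by fastforce
    qed
    have "\<exists>s. 0 < s \<and> s \<le> A * r \<and> c0 * measure M (ball z s) \<le> measure M (ball z s \<inter> \<Omega>) \<and>
      c0 * measure M (ball z s) \<le> measure M (ball z s - \<Omega>)" if z: "z \<in> E" for z
    proof -
      have zd: "dist x0 z < C_hat * r" "z \<notin> closure \<Omega>" using z by (auto simp: E_def)
      have eq: "2 * L * A * (r / (2 * L)) = A * r" using L_ge_1 by simp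
      have "C_hat * r \<le> A * r" using A(2) r by (intro mult_right_mono) auto
      then have "measure M (ball z (A * r)) \<le> c1 * measure M (ball x0 (r / (2 * L)))"
        using zd rho by (intro c1(2)) (simp_all only: eq)
      also have "ball x0 (r / (2 * L)) \<subseteq> ball z (A * r) \<inter> \<Omega>"
      proof
        fix w assume w: "w \<in> ball x0 (r / (2 * L))"
        then have "dist z w < C_hat * r + r"
          using dist_triangle3[of z w x0] zd rho r by simp
        then show "w \<in> ball z (A * r) \<inter> \<Omega>"
          using w inside by (auto simp: A_def algebra_simps)
      qed
      then have "c1 * measure M (ball x0 (r / (2 * L))) \<le> c1 * measure M (ball z (A * r) \<inter> \<Omega>)"
        using c1(1) op by (intro mult_left_mono measure_mono_ball[of _ _ z "A * r"]) auto
      finally have "c0 * measure M (ball z (A * r)) \<le> c0 * (c1 * measure M (ball z (A * r) \<inter> \<Omega>))"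
        using c0(1) by (intro mult_left_mono) auto
      also have "\<dots> = c0 * c1 * measure M (ball z (A * r) \<inter> \<Omega>)" by simp
      also have "\<dots> \<le> 1 * measure M (ball z (A * r) \<inter> \<Omega>)"
        using c0(3) by (intro mult_right_mono) auto
      finally have dens: "c0 * measure M (ball z (A * r)) \<le> measure M (ball z (A * r) \<inter> \<Omega>)" by simp
      have Ar: "0 < A * r" using A r by simp
      obtain s where s: "0 < s" "s \<le> A * r" "c0 * measure M (ball z s) \<le> measure M (ball z s \<inter> \<Omega>)"
        "1 / (2 * D) * measure M (ball z s) \<le> measure M (ball z s - \<Omega>)"
        by (rule intermediate_scale[OF op zd(2) Ar c0(1,2) dens])
      have "c0 * measure M (ball z s) \<le> 1 / (2 * D) * measure M (ball z s)"
        by (intro mult_right_mono c0(4)) auto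
      with s show ?thesis by (intro exI[of _ s]) auto
    qed
    then obtain \<sigma> where \<sigma>: "\<And>z. z \<in> E \<Longrightarrow> 0 < \<sigma> z \<and> \<sigma> z \<le> A * r"
      "\<And>z. z \<in> E \<Longrightarrow> c0 * measure M (ball z (\<sigma> z)) \<le> measure M (ball z (\<sigma> z) \<inter> \<Omega>)"
      "\<And>z. z \<in> E \<Longrightarrow> c0 * measure M (ball z (\<sigma> z)) \<le> measure M (ball z (\<sigma> z) - \<Omega>)"
      by metis
    define near where "near z = {(y, s)\<in>\<C>. ball y (2 * s) \<inter> cball z (L * \<sigma> z) \<noteq> {}}" for z
    \<comment> \<open>Points whose nearby covering balls are all smaller than the chosen scale, as
      \<open>relative_boxing\<close> demands. Any other point lies in a fixed enlargement of a large
      nearby ball.\<close>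
    define I where "I = {z\<in>E. \<forall>(y, s)\<in>near z. s < \<sigma> z}"
    have IE: "I \<subseteq> E" by (auto simp: I_def)
    \<comment> \<open>The selection uses the inflated radii \<open>N * \<sigma> z\<close>, so that
      disjoint balls force disjoint families \<open>near z\<close>.\<close>
    obtain J where J: "J \<subseteq> I" "disjoint_family_on (\<lambda>z. ball z (N * \<sigma> z)) J"
      "\<And>i. i \<in> I \<Longrightarrow> \<exists>j\<in>J. ball i (N * \<sigma> i) \<inter> ball j (N * \<sigma> j) \<noteq> {} \<and> N * \<sigma> i \<le> 2 * (N * \<sigma> j)"
    proof (rule vitali_disjoint_subfamily[of I "\<lambda>z. N * \<sigma> z" "N * (A * r)" "\<lambda>z. z"])
      show "0 < N * \<sigma> i \<and> N * \<sigma> i \<le> N * (A * r)" if "i \<in> I" for i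
        using \<sigma>(1)[of i] that IE N(1) by auto
    qed blast
    have JE: "j \<in> E" "j \<in> I" if "j \<in> J" for j using that J(1) IE by auto
    have ctJ: "countable J"
      using J(2) by (rule countable_disjoint_balls) (use JE \<sigma>(1) N(1) in auto)
    have near_sub: "y \<in> ball z (N * \<sigma> z)" if "z \<in> I" "(y, s) \<in> near z" for y z s
    proof -
      from that have "ball y (2 * s) \<inter> cball z (L * \<sigma> z) \<noteq> {}" "s < \<sigma> z" "0 < \<sigma> z"
        using \<sigma>(1) by (auto simp: near_def I_def)
      then obtain w where "dist y w < 2 * s" "dist z w \<le> L * \<sigma> z" by auto
      then have "dist z y < L * \<sigma> z + 4 * \<sigma> z"
        using dist_triangle2[of z y w] \<open>s < \<sigma> z\<close> \<open>0 < \<sigma> z\<close> by linarith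
      then show ?thesis by (simp add: N_def algebra_simps)
    qed
    have box: "ennreal (c3 * \<xi> z (\<sigma> z)) \<le> (\<Sum>\<^sub>\<infinity>(y, s)\<in>near z. ennreal (\<xi> y s))" if z: "z \<in> I" for z
    proof (rule c3(2)[OF op])
      have zE: "z \<in> E" using z IE by blast
      note s = \<sigma>(1)[OF zE]
      show "countable (near z)" using ct by (rule countable_subset[rotated]) (auto simp: near_def)
      show "0 < \<sigma> z" using s by simp
      show "\<forall>(y, s)\<in>near z. 0 < s \<and> s \<le> \<sigma> z \<and> ball y (2 * s) \<inter> cball z (L * \<sigma> z) \<noteq> {}"
      proof (rule ballI, clarify)
        fix y s assume ys: "(y, s) \<in> near z"
        then have "s < \<sigma> z" using z by (auto simp: I_def)
        moreover have "(y, s) \<in> \<C>" "ball y (2 * s) \<inter> cball z (L * \<sigma> z) \<noteq> {}"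
          using ys by (auto simp: near_def)
        moreover have "0 < s" using calculation rad by blast
        ultimately show "0 < s \<and> s \<le> \<sigma> z \<and> ball y (2 * s) \<inter> cball z (L * \<sigma> z) \<noteq> {}"
          by simp
      qed
      show "frontier \<Omega> \<inter> cball z (L * \<sigma> z) \<subseteq> (\<Union>(y, s)\<in>near z. ball y s)"
      proof
        fix w assume w: "w \<in> frontier \<Omega> \<inter> cball z (L * \<sigma> z)"
        have "L * \<sigma> z \<le> L * (A * r)" using s L_ge_1 by (intro mult_left_mono) auto
        moreover have "0 < L * (A * r)" using s A r L_ge_1 by simp
        moreover have "dist x0 z < C_hat * r" using zE by (simp add: E_def)
        ultimately have "dist x0 w < C_hat * r + 2 * (L * (A * r))"
          using w dist_triangle[of x0 w z] by auto
        then have "w \<in> frontier \<Omega> \<inter> ball x0 (C2 * r)" using w by (simp add: C2_def algebra_simps)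
        then have "w \<in> (\<Union>(y, s)\<in>\<C>. ball y s)" using cov by blast
        then obtain y s where ys: "(y, s) \<in> \<C>" "w \<in> ball y s" by blast
        have "w \<in> ball y (2 * s) \<inter> cball z (L * \<sigma> z)" using ys rad w by auto
        then have "(y, s) \<in> near z" using ys by (auto simp: near_def)
        with ys show "w \<in> (\<Union>(y, s)\<in>near z. ball y s)" by blast
      qed
    qed (use z IE \<sigma> in auto)
    \<comment> \<open>A ball near two selected points would have its centre in two disjoint inflated
      balls.\<close>
    have "disjoint_family_on near J"
      unfolding disjoint_family_on_def
    proof (intro ballI impI)
      fix i j assume ij: "i \<in> J" "j \<in> J" "i \<noteq> j"
      show "near i \<inter> near j = {}"
      proof (rule ccontr)
        assume "near i \<inter> near j \<noteq> {}"
        then obtain y s where "(y, s) \<in> near i" "(y, s) \<in> near j" by auto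
        then have "y \<in> ball i (N * \<sigma> i) \<inter> ball j (N * \<sigma> j)"
          using near_sub JE ij by blast
        then show False using J(2) ij unfolding disjoint_family_on_def by blast
      qed
    qed
    then have "(\<Sum>\<^sub>\<infinity>z\<in>J. (\<Sum>\<^sub>\<infinity>(y, s)\<in>near z. ennreal (\<xi> y s))) \<le> S"
      unfolding S_def by (rule infsum_disjoint_family_le_ennreal) (auto simp: near_def)
    moreover have "(\<Sum>\<^sub>\<infinity>z\<in>J. ennreal c3 * ennreal (\<xi> z (\<sigma> z)))
        \<le> (\<Sum>\<^sub>\<infinity>z\<in>J. (\<Sum>\<^sub>\<infinity>(y, s)\<in>near z. ennreal (\<xi> y s)))"
    proof (intro infsum_mono)
      fix z assume z: "z \<in> J"
      then show "ennreal c3 * ennreal (\<xi> z (\<sigma> z)) \<le> (\<Sum>\<^sub>\<infinity>(y, s)\<in>near z. ennreal (\<xi> y s))"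
        using box[of z] JE[OF z] c3(1) \<sigma>(1)[of z] gauge_pos[of "\<sigma> z" z] by (simp add: ennreal_mult)
    qed auto
    ultimately have "ennreal c3 * (\<Sum>\<^sub>\<infinity>z\<in>J. ennreal (\<xi> z (\<sigma> z))) \<le> S"
      by (simp add: infsum_cmult_ennreal)
    then have "ennreal (1 / c3) * (ennreal c3 * (\<Sum>\<^sub>\<infinity>z\<in>J. ennreal (\<xi> z (\<sigma> z)))) \<le> ennreal (1 / c3) * S"
      by (intro mult_left_mono) auto
    then have Jsum: "(\<Sum>\<^sub>\<infinity>z\<in>J. ennreal (\<xi> z (\<sigma> z))) \<le> ennreal (1 / c3) * S"
      using c3(1) by (simp add: mult.assoc[symmetric] flip: ennreal_mult)
    \<comment> \<open>The given balls account for the frontier and for points near large balls; the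
      selected balls account for \<open>I\<close>.\<close>
    define \<C>' where "\<C>' = \<C> \<union> (\<lambda>z. (z, \<sigma> z)) ` J"
    have inj: "inj_on (\<lambda>z. (z, \<sigma> z)) J" by (auto simp: inj_on_def)
    have "(\<Sum>\<^sub>\<infinity>(y, s)\<in>\<C>'. ennreal (\<xi> y s))
      \<le> S + (\<Sum>\<^sub>\<infinity>(y, s)\<in>(\<lambda>z. (z, \<sigma> z)) ` J. ennreal (\<xi> y s))"
      unfolding \<C>'_def S_def by (rule infsum_Un_le_ennreal)
    also have "(\<Sum>\<^sub>\<infinity>(y, s)\<in>(\<lambda>z. (z, \<sigma> z)) ` J. ennreal (\<xi> y s)) = (\<Sum>\<^sub>\<infinity>z\<in>J. ennreal (\<xi> z (\<sigma> z)))"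
      by (simp add: infsum_reindex[OF inj] o_def)
    also have "S + (\<Sum>\<^sub>\<infinity>z\<in>J. ennreal (\<xi> z (\<sigma> z))) \<le> ennreal 1 * S + ennreal (1 / c3) * S"
      using Jsum by (simp add: add_left_mono)
    also have "\<dots> = ennreal (1 + 1 / c3) * S"
      using c3(1) by (simp add: distrib_right ennreal_plus)
    finally have sum': "(\<Sum>\<^sub>\<infinity>(y, s)\<in>\<C>'. ennreal (\<xi> y s)) \<le> ennreal (1 + 1 / c3) * S" .
    have rad': "\<forall>(y, s)\<in>\<C>'. 0 < s \<and> s \<le> A * r"
    proof (rule ballI, clarify)
      fix y s assume ys: "(y, s) \<in> \<C>'"
      show "0 < s \<and> s \<le> A * r"
      proof (cases "(y, s) \<in> \<C>")
        case True
        then have "0 < s \<and> s \<le> r" using rad by blast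
        moreover have "r \<le> A * r" using A r by simp
        ultimately show ?thesis by linarith
      next
        case False
        then have "y \<in> J" "s = \<sigma> y" using ys by (auto simp: \<C>'_def)
        then show ?thesis using JE(1) \<sigma>(1) by simp
      qed
    qed
    have cov': "ball x0 (C_hat * r) - \<Omega> \<subseteq> (\<Union>(y, s)\<in>\<C>'. ball y (T * s))"
    proof
      fix z assume z: "z \<in> ball x0 (C_hat * r) - \<Omega>"
      \<comment> \<open>The respective enlargements of a ball in the new cover are 1,
        \<open>3 * N\<close> and \<open>L + 2\<close>, all at most \<open>T\<close>.\<close>
      consider "z \<in> frontier \<Omega>" | "z \<in> I" | "z \<in> E - I"
        using z op by (auto simp: E_def frontier_def interior_open)
      then have "\<exists>(y, s)\<in>\<C>'. dist y z < T * s"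
      proof cases
        case 1
        have "C_hat * r \<le> C2 * r" using C2 r by simp
        then have "z \<in> frontier \<Omega> \<inter> ball x0 (C2 * r)" using z 1 by auto
        then have "z \<in> (\<Union>(y, s)\<in>\<C>. ball y s)" using cov by blast
        then obtain y s where ys: "(y, s) \<in> \<C>" "dist y z < s" by auto
        then have "s \<le> T * s" using rad N by auto
        with ys show ?thesis by (intro bexI[of _ "(y, s)"]) (auto simp: \<C>'_def)
      next
        case 2
        then obtain j where j: "j \<in> J" "ball z (N * \<sigma> z) \<inter> ball j (N * \<sigma> j) \<noteq> {}"
          "N * \<sigma> z \<le> 2 * (N * \<sigma> j)" using J(3) by blast
        from j(2) obtain w where "dist z w < N * \<sigma> z" "dist j w < N * \<sigma> j" by auto
        then have "dist j z < 3 * (N * \<sigma> j)" using j(3) dist_triangle2[of j z w] by linarith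
        then show ?thesis using j(1) by (intro bexI[of _ "(j, \<sigma> j)"]) (auto simp: \<C>'_def T_def)
      next
        case 3
        then obtain y s where near: "(y, s) \<in> near z" "\<not> s < \<sigma> z" by (auto simp: I_def)
        then have ys: "(y, s) \<in> \<C>" "ball y (2 * s) \<inter> cball z (L * \<sigma> z) \<noteq> {}" "\<sigma> z \<le> s"
          by (auto simp: near_def)
        from ys(2) obtain w where w: "dist y w < 2 * s" "dist z w \<le> L * \<sigma> z" by auto
        have s: "0 < s" using ys(1) rad by blast
        have "L * \<sigma> z \<le> L * s" using ys L_ge_1 by (intro mult_left_mono) auto
        then have "dist y z < 2 * s + L * s" using w dist_triangle2[of y z w] by linarith
        also have "\<dots> = (2 + L) * s" by (simp add: algebra_simps)
        also have "\<dots> \<le> T * s"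
          using s L_ge_1 by (intro mult_right_mono) (auto simp: T_def N_def)
        finally show ?thesis using ys by (intro bexI[of _ "(y, s)"]) (auto simp: \<C>'_def)
      qed
      then obtain y s where "(y, s) \<in> \<C>'" "z \<in> ball y (T * s)" by auto
      then show "z \<in> (\<Union>(y, s)\<in>\<C>'. ball y (T * s))" by blast
    qed
    have "hausdorff_content \<xi> (ennreal r) (ball x0 (C_hat * r) - \<Omega>)
        \<le> ennreal c4 * (\<Sum>\<^sub>\<infinity>(y, s)\<in>\<C>'. ennreal (\<xi> y s))"
      using ct ctJ by (intro c4(2) r(1) rad' cov') (auto simp: \<C>'_def)
    also have "\<dots> \<le> ennreal c4 * (ennreal (1 + 1 / c3) * S)"
      using sum' by (intro mult_left_mono) auto
    also have "\<dots> = ennreal (c4 * (1 + 1 / c3)) * S"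
      using c4(1) c3(1) by (subst ennreal_mult[of c4]) (simp_all add: mult.assoc)
    finally show ?thesis unfolding S_def .
  qed
  moreover have "1 \<le> c4 * (1 + 1 / c3)"
    using c4(1) c3(1) mult_mono[of 1 c4 1 "1 + 1 / c3"] by simp
  ultimately show ?thesis using C2(1) by blast
qed

end

section \<open>Passage from arbitrary covers of the boundary to its content\<close>

theorem corollary1p7:
  fixes M :: "'a::polish_space measure"
    and \<xi> :: "'a \<Rightarrow> real \<Rightarrow> real"
    and p C_hat :: real
  assumes "radon_measure M"
    and "doubling_measure M"
    and "1 \<le> p"
    and "poincare_inequality M p"
    and "gauge_function \<xi>"
    and "doubling_gauge \<xi>"
    and "codim_greater M \<xi> p"
    and "1 \<le> C_hat"
  shows "\<exists>C2 \<Delta> :: real. 1 \<le> C2 \<and> 0 < \<Delta> \<and>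
    (\<forall>\<Omega> (\<delta>::real). domain \<Omega> \<longrightarrow> \<Omega> \<noteq> UNIV \<longrightarrow> 0 < \<delta> \<longrightarrow> \<delta> < 1 \<longrightarrow>
      (\<forall>x0\<in>\<Omega>.
         hausdorff_content \<xi> (ennreal (infdist x0 (frontier \<Omega>)))
           (ball x0 (C_hat * infdist x0 (frontier \<Omega>)) - \<Omega>)
         \<ge> ennreal (\<delta> * \<xi> x0 (infdist x0 (frontier \<Omega>)))) \<longrightarrow>
      (\<forall>x0\<in>\<Omega>.
         hausdorff_content \<xi> (ennreal (infdist x0 (frontier \<Omega>)))
           (frontier \<Omega> \<inter> ball x0 (C2 * infdist x0 (frontier \<Omega>)))
         \<ge> ennreal (\<Delta> * \<delta> * \<xi> x0 (infdist x0 (frontier \<Omega>)))))"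
proof -
  have sM: "sets M = sets borel" using assms(1) by (simp add: radon_measure_def)
  obtain D where D: "1 \<le> D" "\<And>x r. 0 < r \<Longrightarrow> 0 < emeasure M (ball x (2 * r)) \<and>
          emeasure M (ball x (2 * r)) \<le> ennreal D * emeasure M (ball x r) \<and>
          ennreal D * emeasure M (ball x r) < \<infinity>"
    using assms(2) unfolding doubling_measure_def by blast
  obtain C L where CL: "1 \<le> C" "1 \<le> L" "\<And>f g x r. locally_integrable M f \<Longrightarrow> upper_gradient f g \<Longrightarrow> 0 < r \<Longrightarrow>
          nn_average M (ball x r) (\<lambda>y. ennreal \<bar>f y - average M (ball x r) f\<bar>)
            \<le> ennreal (C * r) *
               ennpowr (nn_average M (ball x (L * r)) (\<lambda>y. ennpowr (g y) p)) (1 / p)"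
    using assms(4) unfolding poincare_inequality_def by blast
  obtain G where G: "\<And>x r x' r'. 0 < r \<Longrightarrow> 0 < r' \<Longrightarrow> ball x r \<inter> ball x' r' \<noteq> {} \<Longrightarrow>
      r' \<le> r \<Longrightarrow> r \<le> 2 * r' \<Longrightarrow> inverse G * \<xi> x' r' \<le> \<xi> x r \<and> \<xi> x r \<le> G * \<xi> x' r'"
    using assms(6) unfolding doubling_gauge_def by blast
  obtain Q K where QK: "p < Q" "1 \<le> K" "\<And>x r R. 0 < r \<Longrightarrow> r \<le> R \<Longrightarrow>
      \<xi> x R / \<xi> x r \<le> K * (codim_gauge M Q x R / codim_gauge M Q x r)"
    using assms(7) unfolding codim_greater_def codim_at_least_def by blast
  have pos: "\<And>x r. 0 < r \<Longrightarrow> 0 < \<xi> x r" using assms(5) by (simp add: gauge_function_def)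
  interpret gauge_space M D C L p \<xi> G K Q
    by unfold_locales (fact sM D CL assms(3) pos G QK)+
  obtain C2 c where C2: "1 \<le> C2" "1 \<le> c" "\<And>\<Omega> x0 r \<C>. open \<Omega> \<Longrightarrow> x0 \<in> \<Omega> \<Longrightarrow> 0 < r \<Longrightarrow>
    r = infdist x0 (frontier \<Omega>) \<Longrightarrow> countable \<C> \<Longrightarrow> (\<forall>(y, s)\<in>\<C>. 0 < s \<and> s \<le> r) \<Longrightarrow>
    frontier \<Omega> \<inter> ball x0 (C2 * r) \<subseteq> (\<Union>(y, s)\<in>\<C>. ball y s) \<Longrightarrow>
    hausdorff_content \<xi> (ennreal r) (ball x0 (C_hat * r) - \<Omega>)
      \<le> ennreal c * (\<Sum>\<^sub>\<infinity>(y, s)\<in>\<C>. ennreal (\<xi> y s))"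
    using hausdorff_content_complement_le[OF assms(8)] by blast
  \<comment> \<open>With \<open>\<Delta> = 1 / c\<close>, the hypothesis bounds the content of the
    complement from below, the boxing inequality bounds it from above by \<open>c\<close> times the
    sum of any cover of the boundary, and the infimum is taken over these covers.\<close>
  have "ennreal (1 / c * \<delta> * \<xi> x0 r) \<le> hausdorff_content \<xi> (ennreal r) (frontier \<Omega> \<inter> ball x0 (C2 * r))"
    if \<Omega>: "domain \<Omega>" "x0 \<in> \<Omega>" and \<delta>: "0 < \<delta>" and r: "r = infdist x0 (frontier \<Omega>)"
      and hyp: "ennreal (\<delta> * \<xi> x0 r) \<le> hausdorff_content \<xi> (ennreal r) (ball x0 (C_hat * r) - \<Omega>)"
    for \<Omega> x0 \<delta> r
  proof (cases "r = 0")
    case True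
    \<comment> \<open>Only junk values are involved: \<open>infdist\<close> to an empty frontier is \<open>0\<close>, and \<open>\<xi>\<close> is evaluated at radius \<open>0\<close>.\<close>
    have "hausdorff_content \<xi> (ennreal r) (ball x0 (C_hat * r) - \<Omega>) \<le> 0"
      using hausdorff_content_le[of "{}" "ennreal r" "{}" \<xi>] True by simp
    then have "ennreal (\<delta> * \<xi> x0 r) = 0" using hyp by (metis le_zero_eq order_trans)
    then have "\<xi> x0 r \<le> 0" using \<delta> by (simp add: ennreal_eq_0_iff mult_le_0_iff)
    then have "1 / c * \<delta> * \<xi> x0 r \<le> 0" using C2(2) \<delta> by (intro mult_nonneg_nonpos) auto
    then show ?thesis by (simp add: ennreal_neg)
  next
    case False
    then have r0: "0 < r" using r infdist_nonneg[of x0 "frontier \<Omega>"] by simp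
    show ?thesis
      unfolding hausdorff_content_def
    proof (rule INF_greatest)
      fix \<C> :: "('a \<times> real) set"
      assume "\<C> \<in> {\<C>. countable \<C> \<and> (\<forall>(x, s)\<in>\<C>. 0 < s \<and> ennreal s \<le> ennreal r) \<and>
          frontier \<Omega> \<inter> ball x0 (C2 * r) \<subseteq> (\<Union>(x, s)\<in>\<C>. ball x s)}"
      then have \<C>: "countable \<C>" "\<forall>(y, s)\<in>\<C>. 0 < s \<and> s \<le> r"
        "frontier \<Omega> \<inter> ball x0 (C2 * r) \<subseteq> (\<Union>(y, s)\<in>\<C>. ball y s)"
        using r0 by (auto simp: ennreal_le_iff)
      have "open \<Omega>" using \<Omega> by (simp add: domain_def)
      then have "ennreal (\<delta> * \<xi> x0 r) \<le> ennreal c * (\<Sum>\<^sub>\<infinity>(y, s)\<in>\<C>. ennreal (\<xi> y s))"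
        using hyp C2(3)[OF _ \<Omega>(2) r0 r \<C>] by (metis order_trans)
      then have "ennreal (1 / c) * ennreal (\<delta> * \<xi> x0 r)
          \<le> ennreal (1 / c) * (ennreal c * (\<Sum>\<^sub>\<infinity>(y, s)\<in>\<C>. ennreal (\<xi> y s)))"
        by (intro mult_left_mono) auto
      then show "ennreal (1 / c * \<delta> * \<xi> x0 r) \<le> (\<Sum>\<^sub>\<infinity>(y, s)\<in>\<C>. ennreal (\<xi> y s))"
        using C2(2) by (simp add: mult.assoc[symmetric] flip: ennreal_mult'')
          (simp add: mult.assoc flip: ennreal_mult')
    qed
  qed
  then show ?thesis
    using C2(1,2) by (intro exI[of _ C2] exI[of _ "1 / c"]) auto
qed

end
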